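(* Let $r\geq3$, and let $G$ be an $n$-vertex $K_r$-minor free graph with maximum spread among all $n$-vertex $K_r$-minor free graphs. If $n$ is sufficiently large, then there is a set $L\subseteq V(G)$ with $|L|=r-2$ such that $G=G[L]\vee(n-r+2)K_1$, i.e. every vertex of $L$ is adjacent to every vertex of $V(G)\setminus L$ and $V(G)\setminus L$ is an independent set (and $G[L]\subseteq K_{r-2}$).
   Context: Spread is $\lambda_1(G)-\lambda_n(G)$, the difference of the largest and smallest adjacency eigenvalues. $G[L]$ is the induced subgraph, $\vee$ denotes the join, $(n-r+2)K_1$ is an edgeless graph on $n-r+2$ vertices. *)

theory Defs
  imports "Jordan_Normal_Form.Char_Poly"
begin

definition simple_graph :: "nat \<Rightarrow> (nat \<Rightarrow> nat \<Rightarrow> bool) \<Rightarrow> bool" where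
  "simple_graph n E \<longleftrightarrow> (\<forall>u v. E u v \<longrightarrow> u < n \<and> v < n \<and> u \<noteq> v \<and> E v u)"

definition adj_matrix :: "nat \<Rightarrow> (nat \<Rightarrow> nat \<Rightarrow> bool) \<Rightarrow> real mat" where
  "adj_matrix n E = mat n n (\<lambda>(i, j). if E i j then 1 else 0)"

definition spread :: "nat \<Rightarrow> (nat \<Rightarrow> nat \<Rightarrow> bool) \<Rightarrow> real" where
  "spread n E = Max {k. eigenvalue (adj_matrix n E) k} - Min {k. eigenvalue (adj_matrix n E) k}"

definition connected_in :: "(nat \<Rightarrow> nat \<Rightarrow> bool) \<Rightarrow> nat set \<Rightarrow> bool" where
  "connected_in E S \<longleftrightarrow> (\<forall>u\<in>S. \<forall>v\<in>S. (\<lambda>x y. E x y \<and> x \<in> S \<and> y \<in> S)\<^sup>*\<^sup>* u v)"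

definition has_K_minor :: "nat \<Rightarrow> nat \<Rightarrow> (nat \<Rightarrow> nat \<Rightarrow> bool) \<Rightarrow> bool" where
  "has_K_minor r n E \<longleftrightarrow> (\<exists>B :: nat \<Rightarrow> nat set.
      (\<forall>i<r. B i \<noteq> {} \<and> B i \<subseteq> {0..<n} \<and> connected_in E (B i)) \<and>
      (\<forall>i<r. \<forall>j<r. i \<noteq> j \<longrightarrow> B i \<inter> B j = {} \<and> (\<exists>u\<in>B i. \<exists>v\<in>B j. E u v)))"

definition K_minor_free :: "nat \<Rightarrow> nat \<Rightarrow> (nat \<Rightarrow> nat \<Rightarrow> bool) \<Rightarrow> bool" where
  "K_minor_free r n E \<longleftrightarrow> \<not> has_K_minor r n E"

end

(*
  A dense graph has a K_r minor, so K_r-minor-free graphs are sparse: with d = 2^r, every vertex set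
  T spans at most d |T| ordered edges. Put s = r - 2. Only boundedly many vertices have degree at
  least \<gamma>^2 n, and all but boundedly many of the others have at most s neighbours among these
  heavy vertices, since s + 1 vertices with many common neighbours give a K_r minor. The edges
  between light vertices contribute O(\<gamma> sqrt n) to the quadratic form, so every eigenvalue is at
  most sqrt (s n) + O(\<gamma> sqrt n) in modulus. As the spread is at least that of K_{s,n-s}, both extreme
  eigenvalues nearly attain this bound, and near equality in Cauchy-Schwarz yields one s-set L that
  is joined to most vertices and on which both extreme eigenvectors are almost constant and large.

  Let t be the number of vertices off L that are not joined to all of L. Minor-freeness bounds the
  number of edges off L by O(t). Test vectors obtained from the two eigenvectors show that deleting
  the edges off L and joining L to everything gains a term of order t and loses at most a small
  multiple of t, both for the largest and for the least eigenvalue. The new graph is again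
  K_r-minor free, so t = 0 by maximality, and then no edge is left off L.
*)
theory Submission
  imports Defs "HOL-Analysis.Function_Topology" "HOL-Analysis.Convex"
begin

section \<open>Minors in dense graphs\<close>

text \<open>An eigenvector for the least eigenvalue has no fixed sign, so all estimates are relative
  to a reference value m of either sign, and one argument serves both ends of the spectrum. The
  constants are chosen backwards. The losses off L stay below the gain once entries off L are at
  most \<delta> |m| with \<delta> = 1/(4(d + 2)). Such closeness follows from a relative
  Cauchy-Schwarz defect of at most \<theta> = \<delta>^2/(2s). A relative loss of \<eta> =
  \<theta>/8 in the quadratic form allows a larger defect at no more than a quarter of the vertices,
  so the sets L found for the two eigenvectors must agree. Finally \<gamma> = \<eta>/(2d + 5): light
  edges and bounded errors lose \<gamma>(d + 2) sqrt n in one eigenvalue, and \<gamma>(d + 3) sqrt n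
  is lost when the lower bound on the spread is shared out between the two. Only then is n taken
  large, to swallow the quantities that depend on r alone.\<close>

definition K_minor_in :: "nat \<Rightarrow> (nat \<Rightarrow> nat \<Rightarrow> bool) \<Rightarrow> nat set \<Rightarrow> bool" where
  "K_minor_in r E S \<longleftrightarrow> (\<exists>B :: nat \<Rightarrow> nat set.
      (\<forall>i<r. B i \<noteq> {} \<and> B i \<subseteq> S \<and> connected_in E (B i)) \<and>
      (\<forall>i<r. \<forall>j<r. i \<noteq> j \<longrightarrow> B i \<inter> B j = {} \<and> (\<exists>u\<in>B i. \<exists>v\<in>B j. E u v)))"

definition deg_in :: "('a \<Rightarrow> 'a \<Rightarrow> bool) \<Rightarrow> 'a set \<Rightarrow> 'a \<Rightarrow> nat" where
  "deg_in E S v = (\<Sum>b\<in>S. of_bool (E v b))"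

text \<open>Ordered pairs are counted, so an undirected edge inside \<open>S\<close> contributes
  2.\<close>

definition vol :: "('a \<Rightarrow> 'a \<Rightarrow> bool) \<Rightarrow> 'a set \<Rightarrow> nat" where
  "vol E S = (\<Sum>v\<in>S. deg_in E S v)"

text \<open>Confining the branch sets to a vertex set lets an induction discard vertices while the
  relation \<open>E\<close> stays fixed.\<close>

lemma has_K_minor_eq: "has_K_minor r n E = K_minor_in r E {0..<n}"
  unfolding has_K_minor_def K_minor_in_def ..

lemma K_minor_in_mono:
  assumes "K_minor_in r E S" "S \<subseteq> T"
  shows "K_minor_in r E T"
proof -
  obtain B where "(\<forall>i<r. B i \<noteq> {} \<and> B i \<subseteq> S \<and> connected_in E (B i)) \<and>
      (\<forall>i<r. \<forall>j<r. i \<noteq> j \<longrightarrow> B i \<inter> B j = {} \<and> (\<exists>u\<in>B i. \<exists>v\<in>B j. E u v))"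
    using assms(1) unfolding K_minor_in_def by (elim exE)
  then show ?thesis
    using assms(2) unfolding K_minor_in_def by (intro exI[of _ B]) (auto dest: subset_trans)
qed

lemma deg_in_card: "finite S \<Longrightarrow> deg_in E S v = card {b\<in>S. E v b}"
  using sum.mono_neutral_cong_right[of S "{b\<in>S. E v b}" "\<lambda>b. of_bool (E v b)" "\<lambda>_. 1::nat"]
  by (simp add: deg_in_def)

lemma connected_in_singleton [simp]: "connected_in E {v}"
  by (simp add: connected_in_def)

lemma connected_in_insert:
  assumes U: "connected_in E U" and u: "u \<in> U" and e: "E u v" "E v u"
  shows "connected_in E (insert v U)"
proof -
  define R where "R x y \<longleftrightarrow> E x y \<and> x \<in> insert v U \<and> y \<in> insert v U" for x y
  have mono: "R\<^sup>*\<^sup>* a b" if "a \<in> U" "b \<in> U" for a b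
  proof -
    have "(\<lambda>x y. E x y \<and> x \<in> U \<and> y \<in> U) \<le> R" by (auto simp: R_def)
    moreover have "(\<lambda>x y. E x y \<and> x \<in> U \<and> y \<in> U)\<^sup>*\<^sup>* a b"
      using U that by (simp add: connected_in_def)
    ultimately show ?thesis by (rule rtranclp_mono[THEN predicate2D])
  qed
  have "R u v" "R v u" using e u by (simp_all add: R_def)
  have to: "R\<^sup>*\<^sup>* a u \<and> R\<^sup>*\<^sup>* u a" if "a \<in> insert v U" for a
  proof (cases "a = v")
    case True
    then show ?thesis using r_into_rtranclp[of R, OF \<open>R u v\<close>] r_into_rtranclp[of R, OF \<open>R v u\<close>] by simp
  next
    case False
    then show ?thesis using that mono[OF _ u] mono[OF u] by simp
  qed
  have "R\<^sup>*\<^sup>* a b" if "a \<in> insert v U" "b \<in> insert v U" for a b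
    using to[OF that(1)] to[OF that(2)] by (blast intro: rtranclp_trans)
  moreover have "(\<lambda>x y. E x y \<and> x \<in> insert v U \<and> y \<in> insert v U) = R"
    by (intro ext) (simp add: R_def)
  ultimately show ?thesis by (simp only: connected_in_def) simp
qed

lemma connected_in_pair: "E u v \<Longrightarrow> E v u \<Longrightarrow> connected_in E {u, v}"
  using connected_in_insert[of E "{u}" u v] by (simp add: insert_commute)

lemma vol_remove:
  assumes "finite S" "v \<in> S" and E: "\<And>a b. E a b \<Longrightarrow> E b a \<and> a \<noteq> b"
  shows "vol E S = vol E (S - {v}) + 2 * deg_in E S v"
proof -
  have vv: "\<not> E v v" using E[of v v] by blast
  have sym: "E a b = E b a" for a b using E[of a b] E[of b a] by blast
  have deg: "deg_in E S a = of_bool (E a v) + deg_in E (S - {v}) a" for a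
    unfolding deg_in_def using assms(1,2) by (rule sum.remove)
  have "vol E S = deg_in E S v + (\<Sum>a\<in>S - {v}. deg_in E S a)"
    unfolding vol_def using assms(1,2) by (rule sum.remove)
  also have "(\<Sum>a\<in>S - {v}. deg_in E S a) = (\<Sum>a\<in>S - {v}. of_bool (E v a)) + vol E (S - {v})"
    unfolding deg vol_def sum.distrib by (simp add: sym)
  also have "(\<Sum>a\<in>S - {v}. of_bool (E v a)) = deg_in E S v"
    unfolding deg[of v] by (simp add: vv deg_in_def)
  finally show ?thesis by simp
qed

text \<open>Contracting a connected set \<open>U\<close> is replaced by counting: the contracted graph has
  \<open>vol E (S - U)\<close> ordered edges plus two for each neighbour of \<open>U\<close>. For a maximal \<open>U\<close> that keeps the density,
  the neighbourhood of \<open>U\<close> has large minimum degree.\<close>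

theorem dense_imp_K_minor:
  assumes E: "\<And>a b. E a b \<Longrightarrow> E b a \<and> a \<noteq> b"
    and "finite S" "S \<noteq> {}" "vol E S \<ge> 2 ^ r * card S"
  shows "K_minor_in r E S"
  using assms(2-)
proof (induction r arbitrary: S)
  case 0
  then show ?case by (simp add: K_minor_in_def)
next
  case (Suc r)
  note outer = Suc.IH
  define c where "c = (2::nat) ^ r"
  have c: "2 ^ Suc r = 2 * c" "c \<ge> 1" by (simp_all add: c_def)
  show ?case using Suc.prems
  proof (induction "card S" arbitrary: S rule: less_induct)
    case less
    note fin = \<open>finite S\<close>
    define N where "N U = {v \<in> S - U. \<exists>u\<in>U. E u v}" for U
    \<comment> \<open>Contracting \<open>U\<close> leaves card S - card U + 1 vertices and vol E (S
      - U) + 2 * card (N U) ordered edges. Membership says that at least 2 * c ordered edges per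
      vertex remain, written without subtraction on naturals.\<close>
    define F where "F = {U. U \<subseteq> S \<and> U \<noteq> {} \<and> connected_in E U \<and>
       2 * c * (card S + 1) \<le> vol E (S - U) + 2 * card (N U) + 2 * c * card U}"
    have "finite F" unfolding F_def by (rule finite_subset[of _ "Pow S"]) (use fin in auto)
    obtain v where v: "v \<in> S" using less.prems by blast
    have "N {v} = {b\<in>S. E v b}" unfolding N_def using E by blast
    then have "card (N {v}) = deg_in E S v" by (simp add: deg_in_card[OF fin])
    then have "{v} \<in> F" unfolding F_def using v less.prems vol_remove[OF fin v E] c by simp
    then have "Max (card ` F) \<in> card ` F" using \<open>finite F\<close> by (intro Max_in) auto
    then obtain U where UF: "U \<in> F" and "card U = Max (card ` F)" by auto
    then have max: "card U' \<le> card U" if "U' \<in> F" for U'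
      using \<open>finite F\<close> that by auto
    have U: "U \<subseteq> S" "U \<noteq> {}" "connected_in E U"
      "2 * c * (card S + 1) \<le> vol E (S - U) + 2 * card (N U) + 2 * c * card U"
      using UF unfolding F_def by auto
    have finU: "finite U" using U(1) fin finite_subset by blast
    have cardSU: "card S = card (S - U) + card U"
      using U(1) fin finU by (simp add: card_Diff_subset card_mono)
    show ?case
    proof (cases "N U = {}")
      \<comment> \<open>The contracted vertex would be isolated, so \<open>S - U\<close> alone is
        dense enough for the inner induction on the size of \<open>S\<close>.\<close>
      case True
      then have *: "2 * c * (card (S - U) + 1) \<le> vol E (S - U)"
        using U(4) cardSU by (simp add: algebra_simps)
      have "S - U \<noteq> {}"
      proof
        assume empty: "S - U = {}"
        show False using * c unfolding empty by (simp add: vol_def)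
      qed
      moreover have "card (S - U) < card S" using U fin
        by (metis cardSU card_gt_0_iff finU less_add_same_cancel1)
      moreover have "2 ^ Suc r * card (S - U) \<le> vol E (S - U)"
        using * unfolding c by (simp add: algebra_simps)
      ultimately have "K_minor_in (Suc r) E (S - U)"
        using less.hyps fin by blast
      then show ?thesis by (rule K_minor_in_mono) blast
    next
      case False
      have finN: "finite (N U)" unfolding N_def using fin by simp
      \<comment> \<open>By maximality, absorbing v must lose more than 2 c ordered edges. Vertices
        in \<open>X\<close> become neighbours of the enlarged set and lose nothing; what is lost is
        the edge from \<open>U\<close> to v and one edge for each neighbour of v in
        \<open>N U\<close>. Hence there are at least c such neighbours.\<close>
      have degN: "c \<le> deg_in E (N U) v" if vN: "v \<in> N U" for v
      proof -
        have v: "v \<in> S - U" and "\<exists>u\<in>U. E u v" using vN unfolding N_def by auto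
        then obtain u where u: "u \<in> U" "E u v" by blast
        have conn: "connected_in E (insert v U)" using connected_in_insert[OF U(3) u(1,2)] E u by blast
        have cardI: "card (insert v U) = Suc (card U)" using finU v by simp
        have "insert v U \<notin> F" using max[of "insert v U"] cardI by auto
        then have lt: "vol E (S - insert v U) + 2 * card (N (insert v U)) + 2 * c * Suc (card U)
            < vol E (S - U) + 2 * card (N U) + 2 * c * card U"
          using U v conn cardI unfolding F_def by auto
        have "S - insert v U = (S - U) - {v}" by blast
        then have vol: "vol E (S - U) = vol E (S - insert v U) + 2 * deg_in E (S - U) v"
          using vol_remove[of "S - U" v E] v fin E by auto
        define X where "X = {b \<in> S - U. E v b \<and> b \<notin> N U}"
        have "N (insert v U) = (N U - {v}) \<union> X"
          unfolding N_def X_def using E by blast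
        moreover have "finite X" "(N U - {v}) \<inter> X = {}" using fin unfolding X_def by auto
        ultimately have cN: "card (N (insert v U)) = card (N U) - 1 + card X"
          using finN vN by (simp add: card_Un_disjoint)
        have "{b \<in> S - U. E v b} = {b \<in> N U. E v b} \<union> X" unfolding X_def N_def by blast
        moreover have "{b \<in> N U. E v b} \<inter> X = {}" unfolding X_def by blast
        ultimately have dg: "deg_in E (S - U) v = deg_in E (N U) v + card X"
          using fin finN \<open>finite X\<close> by (simp add: deg_in_card card_Un_disjoint)
        have "card (N U) \<ge> 1" using vN finN by (auto simp: Suc_le_eq card_gt_0_iff)
        then show ?thesis using lt vol cN dg by simp
      qed
      have "2 ^ r * card (N U) \<le> vol E (N U)"
        unfolding vol_def using sum_mono[of "N U" "\<lambda>_. c" "deg_in E (N U)"] degN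
        by (simp add: c_def mult.commute)
      then have "K_minor_in r E (N U)" using outer finN False by blast
      then obtain B where B: "\<forall>i<r. B i \<noteq> {} \<and> B i \<subseteq> N U \<and> connected_in E (B i)"
        "\<forall>i<r. \<forall>j<r. i \<noteq> j \<longrightarrow> B i \<inter> B j = {} \<and> (\<exists>u\<in>B i. \<exists>v\<in>B j. E u v)"
        unfolding K_minor_in_def by blast
      \<comment> \<open>The other branch sets lie in \<open>N U\<close>, hence are adjacent to
        \<open>U\<close>, which takes the free index r.\<close>
      define B' where "B' = B(r := U)"
      have adj: "B i \<inter> U = {} \<and> (\<exists>u\<in>U. \<exists>v\<in>B i. E u v)" if "i < r" for i
        using B(1) that unfolding N_def by blast
      have adj': "B i \<inter> U = {} \<and> (\<exists>u\<in>B i. \<exists>v\<in>U. E u v)" if "i < r" for i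
        using adj[OF that] E by blast
      have NS: "N U \<subseteq> S" unfolding N_def by blast
      have "K_minor_in (Suc r) E S"
        unfolding K_minor_in_def
      proof (rule exI[of _ B'], intro conjI allI impI)
        fix i assume "i < Suc r"
        then show "B' i \<noteq> {}" "B' i \<subseteq> S" "connected_in E (B' i)"
          using B(1) U NS unfolding B'_def less_Suc_eq by auto
      next
        fix i j assume "i < Suc r" "j < Suc r" "i \<noteq> j"
        then consider "i < r" "j < r" | "i < r" "j = r" | "i = r" "j < r" by linarith
        then have "B' i \<inter> B' j = {} \<and> (\<exists>u\<in>B' i. \<exists>v\<in>B' j. E u v)"
        proof cases
          case 1
          then show ?thesis using B(2) \<open>i \<noteq> j\<close> by (simp add: B'_def)
        next
          case 2
          then show ?thesis using adj'[of i] by (simp add: B'_def)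
        next
          case 3
          then show ?thesis using adj[of j] by (simp add: B'_def Int_commute)
        qed
        then show "B' i \<inter> B' j = {}" "\<exists>u\<in>B' i. \<exists>v\<in>B' j. E u v" by auto
      qed
      then show ?thesis .
    qed
  qed
qed

text \<open>Each vertex of \<open>Q\<close> is paired with a private common neighbour from \<open>F\<close>, which makes the
  pairs mutually adjacent even if \<open>Q\<close> is independent.\<close>

lemma K_minor_common_neighbours:
  assumes E: "\<And>a b. E a b \<Longrightarrow> E b a \<and> a \<noteq> b"
    and fin: "finite Q" "finite F" "card Q \<le> card F"
    and disj: "Q \<inter> F = {}" and sub: "Q \<union> F \<subseteq> S"
    and F: "\<And>f l. f \<in> F \<Longrightarrow> l \<in> Q \<Longrightarrow> E f l"
    and P: "\<And>i. i < k \<Longrightarrow> P i \<subseteq> S - Q - F \<and> connected_in E (P i) \<and> (\<exists>w\<in>P i. \<forall>l\<in>Q. E w l)"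
    and PP: "\<And>i j. i < k \<Longrightarrow> j < k \<Longrightarrow> i \<noteq> j \<Longrightarrow> P i \<inter> P j = {} \<and> (\<exists>u\<in>P i. \<exists>v\<in>P j. E u v)"
  shows "K_minor_in (card Q + k) E S"
proof -
  obtain l where l: "bij_betw l {0..<card Q} Q" using ex_bij_betw_nat_finite[OF fin(1)] by blast
  obtain f where f: "bij_betw f {0..<card F} F" using ex_bij_betw_nat_finite[OF fin(2)] by blast
  let ?q = "card Q"
  define B where "B i = (if i < ?q then {l i, f i} else P (i - ?q))" for i
  have lQ: "l i \<in> Q" if "i < ?q" for i using l that by (auto simp: bij_betw_def)
  have fF: "f i \<in> F" if "i < ?q" for i using f that fin(3) by (auto simp: bij_betw_def)
  have linj: "l i \<noteq> l j" if "i < ?q" "j < ?q" "i \<noteq> j" for i j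
    using l that by (auto simp: bij_betw_def inj_on_def)
  have finj: "f i \<noteq> f j" if "i < ?q" "j < ?q" "i \<noteq> j" for i j
    using f that fin(3) by (auto simp: bij_betw_def inj_on_def)
  have lf: "l i \<noteq> f j" if "i < ?q" "j < ?q" for i j using lQ[OF that(1)] fF[OF that(2)] disj by auto
  have Efl: "E (f i) (l j)" "E (l j) (f i)" if "i < ?q" "j < ?q" for i j
    using F[OF fF[OF that(1)] lQ[OF that(2)]] E[of "f i" "l j"] by simp_all
  show ?thesis unfolding K_minor_in_def
  proof (rule exI[of _ B], intro conjI allI impI)
    fix i assume i: "i < ?q + k"
    show "B i \<noteq> {}" "B i \<subseteq> S" "connected_in E (B i)"
    proof -
      consider "i < ?q" | "i \<ge> ?q" "i - ?q < k" using i by linarith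
      then have "B i \<noteq> {} \<and> B i \<subseteq> S \<and> connected_in E (B i)"
      proof cases
        case 1
        then show ?thesis using lQ[OF 1] fF[OF 1] sub Efl[OF 1 1]
          by (auto simp: B_def intro: connected_in_pair)
      next
        case 2
        then show ?thesis using P[OF 2(2)] by (auto simp: B_def)
      qed
      then show "B i \<noteq> {}" "B i \<subseteq> S" "connected_in E (B i)" by auto
    qed
  next
    fix i j assume ij: "i < ?q + k" "j < ?q + k" "i \<noteq> j"
    have mixed: "B a \<inter> B b = {} \<and> (\<exists>u\<in>B a. \<exists>v\<in>B b. E u v) \<and> (\<exists>u\<in>B b. \<exists>v\<in>B a. E u v)"
      if ab: "a < ?q" "b \<ge> ?q" "b - ?q < k" for a b
    proof -
      obtain w where w: "w \<in> P (b - ?q)" "\<forall>l\<in>Q. E w l" using P[OF ab(3)] by blast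
      then have "E w (l a)" "E (l a) w" using lQ[OF ab(1)] E[of w "l a"] by simp_all
      moreover have "B b = P (b - ?q)" "B a = {l a, f a}" using ab by (auto simp: B_def)
      moreover have "P (b - ?q) \<inter> {l a, f a} = {}" using P[OF ab(3)] lQ[OF ab(1)] fF[OF ab(1)] by auto
      ultimately show ?thesis using w(1)
        by (intro conjI) (simp add: Int_commute, rule bexI[of _ "l a"], rule bexI[of _ w], simp_all, rule bexI[of _ w], simp_all)
    qed
    have split: "a < ?q \<or> a \<ge> ?q \<and> a - ?q < k" if "a < ?q + k" for a
      using that by (cases "a < ?q") auto
    let ?A = "\<lambda>i j. B i \<inter> B j = {} \<and> (\<exists>u\<in>B i. \<exists>v\<in>B j. E u v)"
    have 1: "?A i j" if ij': "i < ?q" "j < ?q"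
    proof -
      have "l i \<noteq> l j" "f i \<noteq> f j" "l i \<noteq> f j" "l j \<noteq> f i" "E (l i) (f j)"
        using linj[OF ij' ij(3)] finj[OF ij' ij(3)] lf[OF ij'] lf[OF ij'(2,1)] Efl[OF ij'(2,1)]
        by simp_all
      moreover have "B i = {l i, f i}" "B j = {l j, f j}" using ij' by (simp_all add: B_def)
      ultimately show ?thesis by simp
    qed
    have 2: "?A i j" if "i < ?q" "j \<ge> ?q \<and> j - ?q < k"
      using mixed[of i j] that by simp
    have 3: "?A i j" if "j < ?q" "i \<ge> ?q \<and> i - ?q < k"
      using mixed[of j i] that by (simp add: Int_commute)
    have 4: "?A i j" if "i \<ge> ?q \<and> i - ?q < k" "j \<ge> ?q \<and> j - ?q < k"
    proof -
      have "i - ?q \<noteq> j - ?q" using ij(3) that by linarith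
      then show ?thesis using PP[of "i - ?q" "j - ?q"] that by (simp add: B_def)
    qed
    have "?A i j" using split[OF ij(1)] split[OF ij(2)] 1 2 3 4 by argo
    then show "B i \<inter> B j = {}" "\<exists>u\<in>B i. \<exists>v\<in>B j. E u v" by auto
  qed
qed

text \<open>At most \<open>card L\<close> branch sets meet \<open>L\<close>, and the others are pairwise adjacent.\<close>

lemma K_minor_free_cover:
  assumes "finite L" "card L + 2 \<le> r"
    and indep: "\<And>u v. E u v \<Longrightarrow> u \<in> L \<or> v \<in> L"
  shows "\<not> K_minor_in r E S"
proof
  assume "K_minor_in r E S"
  then obtain B where B:
     "\<forall>i<r. \<forall>j<r. i \<noteq> j \<longrightarrow> B i \<inter> B j = {} \<and> (\<exists>u\<in>B i. \<exists>v\<in>B j. E u v)"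
    unfolding K_minor_in_def by (elim exE conjE) (rule that)
  define I where "I = {i. i < r \<and> B i \<inter> L \<noteq> {}}"
  have I: "I \<subseteq> {0..<r}" unfolding I_def by auto
  have "\<exists>g. \<forall>i\<in>I. g i \<in> B i \<inter> L" by (rule bchoice) (auto simp: I_def)
  then obtain g where g: "\<And>i. i \<in> I \<Longrightarrow> g i \<in> B i \<inter> L" by metis
  have "inj_on g I"
  proof (rule inj_onI)
    fix i j assume ij: "i \<in> I" "j \<in> I" "g i = g j"
    then have "g i \<in> B i \<inter> B j" using g[of i] g[of j] by auto
    moreover have "i < r" "j < r" using ij unfolding I_def by auto
    ultimately show "i = j" using B by (metis empty_iff)
  qed
  moreover have "g ` I \<subseteq> L" using g by blast
  ultimately have "card I \<le> card L" using assms(1) by (rule card_inj_on_le)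
  moreover have "card ({0..<r} - I) = r - card I"
    using card_Diff_subset[of I "{0..<r}"] I by (simp add: finite_subset)
  ultimately have "2 \<le> card ({0..<r} - I)" using assms(2) by linarith
  then obtain J where J: "J \<subseteq> {0..<r} - I" "card J = 2" by (meson obtain_subset_with_card_n)
  obtain i j where "J = {i, j}" "i \<noteq> j" using J(2) unfolding card_2_iff by blast
  then have ij: "i \<in> {0..<r} - I" "j \<in> {0..<r} - I" "i \<noteq> j" using J(1) by blast+
  then have "B i \<inter> L = {}" "B j \<inter> L = {}" "\<exists>u\<in>B i. \<exists>v\<in>B j. E u v"
    using B unfolding I_def by auto
  then show False using indep by fast
qed

section \<open>Extremal eigenvalues and Rayleigh quotients\<close>

text \<open>Compactness of the unit sphere gives a maximizer, and scaling extends the inequality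
  from unit vectors to all \<open>y\<close>.\<close>

lemma quadratic_form_attains_max:
  fixes a :: "'i \<Rightarrow> 'i \<Rightarrow> real"
  assumes V: "finite V" "V \<noteq> {}"
  obtains x \<mu> where "(\<Sum>i\<in>V. (x i)\<^sup>2) = 1" "(\<Sum>i\<in>V. \<Sum>j\<in>V. a i j * (x i * x j)) = \<mu>"
    "\<And>y. (\<Sum>i\<in>V. \<Sum>j\<in>V. a i j * (y i * y j)) \<le> \<mu> * (\<Sum>i\<in>V. (y i)\<^sup>2)"
proof -
  define q where "q y = (\<Sum>i\<in>V. \<Sum>j\<in>V. a i j * (y i * y j))" for y
  \<comment> \<open>The index type may be infinite; coordinates off \<open>V\<close> are pinned to
    0, so that the product is compact by Tychonoff.\<close>
  define C where "C = PiE UNIV (\<lambda>i. if i \<in> V then {-1..1} else {0::real})"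
  define S where "S = C \<inter> {x. (\<Sum>i\<in>V. (x i)\<^sup>2) = 1}"
  have coord: "continuous_on A (\<lambda>x :: 'i \<Rightarrow> real. x i)" for A i
    by (rule continuous_on_product_then_coordinatewise) (rule continuous_on_id)
  have "compactin (product_topology (\<lambda>_::'i. euclideanreal) UNIV) C"
    unfolding C_def by (subst compactin_PiE) (auto simp: compactin_euclidean_iff)
  then have "compact C"
    by (simp add: euclidean_product_topology compactin_euclidean_iff)
  moreover have "closed {x :: 'i \<Rightarrow> real. (\<Sum>i\<in>V. (x i)\<^sup>2) = 1}"
    by (intro closed_Collect_eq continuous_intros coord)
  ultimately have "compact S" unfolding S_def by (rule compact_Int_closed)
  obtain i0 where i0: "i0 \<in> V" using V by blast
  have "(\<lambda>i. if i = i0 then 1 else 0) \<in> S"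
    using i0 V unfolding S_def C_def by (auto simp: if_distrib[of "\<lambda>x. x\<^sup>2"] split: if_splits cong: if_cong)
  then have "S \<noteq> {}" by blast
  have "continuous_on S q" unfolding q_def by (intro continuous_intros coord)
  then obtain x where x: "x \<in> S" "\<And>y. y \<in> S \<Longrightarrow> q y \<le> q x"
    using continuous_attains_sup[OF \<open>compact S\<close> \<open>S \<noteq> {}\<close>] by blast
  have "q y \<le> q x * (\<Sum>i\<in>V. (y i)\<^sup>2)" for y
  proof -
    define t where "t = (\<Sum>i\<in>V. (y i)\<^sup>2)"
    have "t \<ge> 0" unfolding t_def by (intro sum_nonneg) simp
    show ?thesis
    proof (cases "t = 0")
      case True
      then have "y i = 0" if "i \<in> V" for i
        using that V(1) unfolding t_def by (simp add: sum_nonneg_eq_0_iff)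
      then show ?thesis by (simp add: q_def)
    next
      case False
      with \<open>t \<ge> 0\<close> have "t > 0" by simp
      define z where "z i = (if i \<in> V then y i / sqrt t else 0)" for i
      have sq: "(\<Sum>i\<in>V. (z i)\<^sup>2) = 1"
      proof -
        have "(\<Sum>i\<in>V. (z i)\<^sup>2) = (\<Sum>i\<in>V. (y i)\<^sup>2 / t)"
          using \<open>t > 0\<close> by (intro sum.cong) (auto simp: z_def power_divide)
        also have "\<dots> = 1" using \<open>t > 0\<close> by (simp add: t_def flip: sum_divide_distrib)
        finally show ?thesis .
      qed
      have z_le: "\<bar>z i\<bar> \<le> 1" if "i \<in> V" for i
      proof -
        have "(z i)\<^sup>2 \<le> (\<Sum>i\<in>V. (z i)\<^sup>2)"
          using that V(1) by (intro member_le_sum) auto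
        then show ?thesis using sq by (simp add: abs_square_le_1)
      qed
      have "z i \<in> (if i \<in> V then {-1..1} else {0})" for i
        using z_le[of i] by (cases "i \<in> V") (auto simp: z_def[of i] abs_le_iff simp del: abs_divide)
      then have "z \<in> C" unfolding C_def by (simp only: PiE_UNIV_domain Pi_iff) simp
      then have "q z \<le> q x" using sq by (intro x(2)) (simp add: S_def)
      moreover have "q z = q y / t"
      proof -
        have "q z = (\<Sum>i\<in>V. \<Sum>j\<in>V. a i j * (y i * y j) / t)"
          unfolding q_def using \<open>t > 0\<close> by (intro sum.cong refl) (simp add: z_def)
        then show ?thesis by (simp add: q_def sum_divide_distrib)
      qed
      ultimately show ?thesis using \<open>t > 0\<close> by (simp add: field_simps t_def)
    qed
  qed
  then show ?thesis using x(1) by (intro that[of x "q x"]) (auto simp: S_def q_def)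
qed

text \<open>First variation: perturbing the maximizer \<open>x\<close> in the direction of the residual
  \<open>a x - \<mu> x\<close> would increase the form unless the residual vanishes.\<close>

lemma symmetric_max_eigenpair:
  fixes a :: "'i \<Rightarrow> 'i \<Rightarrow> real"
  assumes V: "finite V" "V \<noteq> {}" and sym: "\<And>i j. a i j = a j i"
  obtains x \<mu> where "(\<Sum>i\<in>V. (x i)\<^sup>2) = 1" "\<And>i. i \<in> V \<Longrightarrow> (\<Sum>j\<in>V. a i j * x j) = \<mu> * x i"
    "\<And>y. (\<Sum>i\<in>V. \<Sum>j\<in>V. a i j * (y i * y j)) \<le> \<mu> * (\<Sum>i\<in>V. (y i)\<^sup>2)"
proof -
  obtain x \<mu> where x: "(\<Sum>i\<in>V. (x i)\<^sup>2) = 1" "(\<Sum>i\<in>V. \<Sum>j\<in>V. a i j * (x i * x j)) = \<mu>"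
    and max: "\<And>y. (\<Sum>i\<in>V. \<Sum>j\<in>V. a i j * (y i * y j)) \<le> \<mu> * (\<Sum>i\<in>V. (y i)\<^sup>2)"
    by (rule quadratic_form_attains_max[OF V, of a]) (rule that)
  define w where "w i = (\<Sum>j\<in>V. a i j * x j) - \<mu> * x i" for i
  define W where "W = (\<Sum>i\<in>V. (w i)\<^sup>2)"
  define D where "D = (\<Sum>i\<in>V. \<Sum>j\<in>V. a i j * (w i * w j)) - \<mu> * W"
  have W: "W = (\<Sum>i\<in>V. \<Sum>j\<in>V. a i j * (w i * x j)) - \<mu> * (\<Sum>i\<in>V. w i * x i)"
  proof -
    have "(w i)\<^sup>2 = (\<Sum>j\<in>V. a i j * (w i * x j)) - \<mu> * (w i * x i)" for i
    proof -
      have "(w i)\<^sup>2 = w i * ((\<Sum>j\<in>V. a i j * x j) - \<mu> * x i)"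
        unfolding power2_eq_square by (simp add: w_def)
      also have "\<dots> = (\<Sum>j\<in>V. a i j * (w i * x j)) - \<mu> * (w i * x i)"
        by (simp add: algebra_simps sum_distrib_left)
      finally show ?thesis .
    qed
    then show ?thesis by (simp add: W_def sum_subtractf sum_distrib_left)
  qed
  have wx: "(\<Sum>i\<in>V. \<Sum>j\<in>V. a i j * (x i * w j)) = (\<Sum>i\<in>V. \<Sum>j\<in>V. a i j * (w i * x j))"
    by (subst sum.swap, intro sum.cong refl) (simp add: sym mult.commute)
  \<comment> \<open>The form minus \<mu> times the squared norm, expanded at x + t w: the linear
    coefficient is 2 W and the quadratic one is D.\<close>
  have *: "2 * t * W + t\<^sup>2 * D \<le> 0" for t
  proof -
    define y where "y i = x i + t * w i" for i
    have 1: "(\<Sum>i\<in>V. \<Sum>j\<in>V. a i j * (y i * y j)) =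
       (\<Sum>i\<in>V. \<Sum>j\<in>V. a i j * (x i * x j)) + t * (\<Sum>i\<in>V. \<Sum>j\<in>V. a i j * (x i * w j))
       + t * (\<Sum>i\<in>V. \<Sum>j\<in>V. a i j * (w i * x j)) + t\<^sup>2 * (\<Sum>i\<in>V. \<Sum>j\<in>V. a i j * (w i * w j))"
      unfolding sum_distrib_left sum.distrib[symmetric]
      by (intro sum.cong refl) (simp add: y_def algebra_simps power2_eq_square)
    have 2: "(\<Sum>i\<in>V. (y i)\<^sup>2) = (\<Sum>i\<in>V. (x i)\<^sup>2) + 2 * t * (\<Sum>i\<in>V. w i * x i) + t\<^sup>2 * W"
      unfolding W_def sum_distrib_left sum.distrib[symmetric]
      by (intro sum.cong refl) (simp add: y_def algebra_simps power2_eq_square)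
    define P where "P = (\<Sum>i\<in>V. w i * x i)"
    have 3: "(\<Sum>i\<in>V. \<Sum>j\<in>V. a i j * (w i * x j)) = W + \<mu> * P" using W by (simp add: P_def)
    have 4: "(\<Sum>i\<in>V. \<Sum>j\<in>V. a i j * (w i * w j)) = D + \<mu> * W" by (simp add: D_def)
    have "\<mu> + t * (W + \<mu> * P) + t * (W + \<mu> * P) + t\<^sup>2 * (D + \<mu> * W) \<le> \<mu> * (1 + 2 * t * P + t\<^sup>2 * W)"
      using max[of y] unfolding 1 2 x wx 3 4 P_def[symmetric] by simp
    then show ?thesis by (simp add: algebra_simps)
  qed
  have "W = 0"
  proof (rule ccontr)
    assume "W \<noteq> 0"
    then have "W > 0" unfolding W_def using sum_nonneg[of V "\<lambda>i. (w i)\<^sup>2"] by simp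
    \<comment> \<open>Small enough that the quadratic term cannot offset the linear one: t |D| \<le>
      W < 2 W.\<close>
    define t where "t = W / (1 + \<bar>D\<bar>)"
    have "t > 0" using \<open>W > 0\<close> by (simp add: t_def add_pos_nonneg)
    have "t * \<bar>D\<bar> \<le> W" using \<open>W > 0\<close> by (simp add: t_def field_simps)
    then have "2 * W + t * D > 0" using \<open>W > 0\<close> \<open>t > 0\<close> abs_le_iff[of "t * D" W] by (simp add: abs_mult)
    then have "t * (2 * W + t * D) > 0" using \<open>t > 0\<close> by simp
    then show False using *[of t] by (simp add: algebra_simps power2_eq_square)
  qed
  then have "w i = 0" if "i \<in> V" for i
    using that V(1) unfolding W_def by (simp add: sum_nonneg_eq_0_iff)
  then show ?thesis using that[of x \<mu>] x max by (simp add: w_def)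
qed

section \<open>Extreme eigenvalues of the adjacency matrix\<close>

definition adj :: "('a \<Rightarrow> 'a \<Rightarrow> bool) \<Rightarrow> 'a \<Rightarrow> 'a \<Rightarrow> real" where
  "adj E u v = of_bool (E u v)"

text \<open>Bounded by the Rayleigh quotients, \<open>\<rho>\<close> is the largest eigenvalue and \<open>\<mu>\<close> the least one.\<close>

lemma spread_eigenpairs:
  assumes "simple_graph n E" "n > 0"
  obtains \<rho> \<mu> x z where "spread n E = \<rho> - \<mu>"
    "(\<Sum>i\<in>{0..<n}. (x i)\<^sup>2) = 1" "\<And>i. i < n \<Longrightarrow> (\<Sum>j\<in>{0..<n}. adj E i j * x j) = \<rho> * x i"
    "\<And>y. (\<Sum>i\<in>{0..<n}. \<Sum>j\<in>{0..<n}. adj E i j * (y i * y j)) \<le> \<rho> * (\<Sum>i\<in>{0..<n}. (y i)\<^sup>2)"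
    "(\<Sum>i\<in>{0..<n}. (z i)\<^sup>2) = 1" "\<And>i. i < n \<Longrightarrow> (\<Sum>j\<in>{0..<n}. adj E i j * z j) = \<mu> * z i"
    "\<And>y. (\<Sum>i\<in>{0..<n}. \<Sum>j\<in>{0..<n}. adj E i j * (y i * y j)) \<ge> \<mu> * (\<Sum>i\<in>{0..<n}. (y i)\<^sup>2)"
proof -
  let ?V = "{0..<n}" and ?A = "adj_matrix n E"
  define a where "a = adj E"
  have A: "?A \<in> carrier_mat n n" by (simp add: adj_matrix_def)
  have sym: "a i j = a j i" for i j
  proof -
    have "E i j = E j i" using assms(1) unfolding simple_graph_def by blast
    then show ?thesis by (simp add: a_def adj_def)
  qed
  have V: "finite ?V" "?V \<noteq> {}" using assms(2) by auto
  obtain x \<rho> where x: "(\<Sum>i\<in>?V. (x i)\<^sup>2) = 1" "\<And>i. i \<in> ?V \<Longrightarrow> (\<Sum>j\<in>?V. a i j * x j) = \<rho> * x i"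
    "\<And>y. (\<Sum>i\<in>?V. \<Sum>j\<in>?V. a i j * (y i * y j)) \<le> \<rho> * (\<Sum>i\<in>?V. (y i)\<^sup>2)"
    by (rule symmetric_max_eigenpair[OF V, of a, OF sym]) (rule that)
  \<comment> \<open>The least eigenvalue is minus the largest one of the negated matrix.\<close>
  obtain z \<mu>' where z': "(\<Sum>i\<in>?V. (z i)\<^sup>2) = 1" "\<And>i. i \<in> ?V \<Longrightarrow> (\<Sum>j\<in>?V. - a i j * z j) = \<mu>' * z i"
    "\<And>y. (\<Sum>i\<in>?V. \<Sum>j\<in>?V. - a i j * (y i * y j)) \<le> \<mu>' * (\<Sum>i\<in>?V. (y i)\<^sup>2)"
    by (rule symmetric_max_eigenpair[OF V, of "\<lambda>i j. - a i j"]) (simp only: sym, rule that)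
  define \<mu> where "\<mu> = - \<mu>'"
  have z: "(\<Sum>i\<in>?V. (z i)\<^sup>2) = 1" "\<And>i. i \<in> ?V \<Longrightarrow> (\<Sum>j\<in>?V. a i j * z j) = \<mu> * z i"
    "\<And>y. (\<Sum>i\<in>?V. \<Sum>j\<in>?V. a i j * (y i * y j)) \<ge> \<mu> * (\<Sum>i\<in>?V. (y i)\<^sup>2)"
  proof -
    show "(\<Sum>j\<in>?V. a i j * z j) = \<mu> * z i" if "i \<in> ?V" for i
      using z'(2)[OF that] by (simp add: \<mu>_def sum_negf)
    show "\<mu> * (\<Sum>i\<in>?V. (y i)\<^sup>2) \<le> (\<Sum>i\<in>?V. \<Sum>j\<in>?V. a i j * (y i * y j))" for y
      using z'(3)[of y] by (simp add: \<mu>_def sum_negf)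
  qed (rule z'(1))
  have ev: "eigenvalue ?A k \<longleftrightarrow> (\<exists>y. (\<exists>i<n. y i \<noteq> 0) \<and> (\<forall>i<n. (\<Sum>j\<in>?V. a i j * y j) = k * y i))" for k
  proof
    assume "eigenvalue ?A k"
    then obtain v where v: "v \<in> carrier_vec n" "v \<noteq> 0\<^sub>v n" "?A *\<^sub>v v = k \<cdot>\<^sub>v v"
      using A unfolding eigenvalue_def eigenvector_def by auto
    have "(\<Sum>j\<in>?V. a i j * v $ j) = k * v $ i" if "i < n" for i
    proof -
      have "(?A *\<^sub>v v) $ i = (\<Sum>j\<in>?V. a i j * v $ j)"
        using that v(1) by (auto simp: adj_matrix_def scalar_prod_def a_def adj_def of_bool_def intro!: sum.cong)
      then show ?thesis using v that by simp
    qed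
    moreover have "\<exists>i<n. v $ i \<noteq> 0" using v(1,2) by auto
    ultimately show "\<exists>y. (\<exists>i<n. y i \<noteq> 0) \<and> (\<forall>i<n. (\<Sum>j\<in>?V. a i j * y j) = k * y i)" by blast
  next
    assume "\<exists>y. (\<exists>i<n. y i \<noteq> 0) \<and> (\<forall>i<n. (\<Sum>j\<in>?V. a i j * y j) = k * y i)"
    then obtain y i0 where y: "i0 < n" "y i0 \<noteq> 0" "\<And>i. i < n \<Longrightarrow> (\<Sum>j\<in>?V. a i j * y j) = k * y i" by blast
    have "vec n y \<noteq> 0\<^sub>v n"
    proof
      assume "vec n y = 0\<^sub>v n"
      then have "vec n y $ i0 = 0\<^sub>v n $ i0" by simp
      then show False using y by simp
    qed
    moreover have "?A *\<^sub>v vec n y = k \<cdot>\<^sub>v vec n y"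
    proof (rule eq_vecI)
      fix i assume "i < dim_vec (k \<cdot>\<^sub>v vec n y)"
      then have i: "i < n" by simp
      have "(?A *\<^sub>v vec n y) $ i = (\<Sum>j\<in>?V. a i j * y j)"
        using i by (auto simp: adj_matrix_def scalar_prod_def a_def adj_def of_bool_def intro!: sum.cong)
      then show "(?A *\<^sub>v vec n y) $ i = (k \<cdot>\<^sub>v vec n y) $ i" using y(3)[OF i] i by simp
    qed (simp add: adj_matrix_def)
    ultimately show "eigenvalue ?A k"
      using A unfolding eigenvalue_def eigenvector_def by (intro exI[of _ "vec n y"]) auto
  qed
  have form: "(\<Sum>i\<in>?V. \<Sum>j\<in>?V. a i j * (y i * y j)) = k * (\<Sum>i\<in>?V. (y i)\<^sup>2)"
    if y: "\<And>i. i < n \<Longrightarrow> (\<Sum>j\<in>?V. a i j * y j) = k * y i" for y k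
  proof -
    have "(\<Sum>j\<in>?V. a i j * (y i * y j)) = k * (y i)\<^sup>2" if i: "i < n" for i
    proof -
      have "(\<Sum>j\<in>?V. a i j * (y i * y j)) = y i * (\<Sum>j\<in>?V. a i j * y j)"
        by (simp add: sum_distrib_left mult.left_commute)
      then show ?thesis using y[OF i] by (simp add: power2_eq_square)
    qed
    then have "(\<Sum>i\<in>?V. \<Sum>j\<in>?V. a i j * (y i * y j)) = (\<Sum>i\<in>?V. k * (y i)\<^sup>2)"
      by (intro sum.cong) auto
    then show ?thesis by (simp add: sum_distrib_left)
  qed
  have bounds: "\<mu> \<le> k \<and> k \<le> \<rho>" if k: "eigenvalue ?A k" for k
  proof -
    obtain y i0 where y: "i0 < n" "y i0 \<noteq> 0" "\<And>i. i < n \<Longrightarrow> (\<Sum>j\<in>?V. a i j * y j) = k * y i"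
      using k unfolding ev by blast
    have "(y i0)\<^sup>2 \<le> (\<Sum>i\<in>?V. (y i)\<^sup>2)" using y(1) by (intro member_le_sum) auto
    then have pos: "(\<Sum>i\<in>?V. (y i)\<^sup>2) > 0" using y(2) zero_less_power2[of "y i0"] by linarith
    show ?thesis using x(3)[of y] z(3)[of y] form[OF y(3)] pos by simp
  qed
  have nz: "\<exists>i<n. y i \<noteq> 0" if "(\<Sum>i\<in>?V. (y i)\<^sup>2) = 1" for y :: "nat \<Rightarrow> real"
  proof (rule ccontr)
    assume "\<not> (\<exists>i<n. y i \<noteq> 0)"
    then have "(\<Sum>i\<in>?V. (y i)\<^sup>2) = 0" by simp
    with that show False by simp
  qed
  have "eigenvalue ?A \<rho>" "eigenvalue ?A \<mu>"
    unfolding ev using x z nz[OF x(1)] nz[OF z(1)] by auto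
  \<comment> \<open>\<open>Max\<close> and \<open>Min\<close> are meaningful for finite sets; the
    eigenvalues are roots of a nonzero polynomial.\<close>
  moreover have "finite {k. eigenvalue ?A k}"
  proof -
    have "char_poly ?A \<noteq> 0" using degree_monic_char_poly[OF A] by auto
    then show ?thesis using eigenvalue_root_char_poly[OF A] poly_roots_finite[of "char_poly ?A"] by simp
  qed
  ultimately have "Max {k. eigenvalue ?A k} = \<rho>" "Min {k. eigenvalue ?A k} = \<mu>"
    using bounds by (auto intro!: Max_eqI Min_eqI)
  then have "spread n E = \<rho> - \<mu>" by (simp add: spread_def)
  then show ?thesis using that[of \<rho> \<mu> x z] x z unfolding a_def by simp
qed

section \<open>Quadratic forms of sparse graphs\<close>

lemma real_deg_in: "real (deg_in E S v) = (\<Sum>b\<in>S. adj E v b)"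
  by (simp add: deg_in_def adj_def)

lemma adj_nonneg [simp]: "0 \<le> adj E u v" and adj_le_1: "adj E u v \<le> 1"
  by (simp_all add: adj_def)

lemma sum_adj: "finite S \<Longrightarrow> (\<Sum>l\<in>S. adj E u l * x l) = (\<Sum>l | l \<in> S \<and> E u l. x l)"
  by (rule sum.mono_neutral_cong_right) (auto simp: adj_def)

lemma ex_deg_in_le:
  assumes "finite S" "S \<noteq> {}" "vol E S \<le> d * card S"
  shows "\<exists>v\<in>S. deg_in E S v \<le> d"
proof (rule ccontr)
  assume "\<not> (\<exists>v\<in>S. deg_in E S v \<le> d)"
  then have "(\<Sum>v\<in>S. d) < vol E S"
    unfolding vol_def using assms(1,2) by (intro sum_strict_mono) auto
  then show False using assms(3) by (simp add: mult.commute)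
qed

text \<open>Removing a vertex of degree at most \<open>d\<close> and splitting its edge terms by weighted AM-GM
  amounts to orienting the graph with out-degrees at most \<open>d\<close>.\<close>

lemma adjacency_form_bound:
  fixes x :: "'a \<Rightarrow> real"
  assumes E: "\<And>a b. E a b \<Longrightarrow> E b a \<and> a \<noteq> b" and "finite S"
    and "\<And>T. T \<subseteq> S \<Longrightarrow> vol E T \<le> d * card T" and c: "c > 0"
  shows "(\<Sum>a\<in>S. \<Sum>b\<in>S. adj E a b * (\<bar>x a\<bar> * \<bar>x b\<bar>)) \<le>
    (\<Sum>a\<in>S. (c * d + deg_in E S a / c) * (x a)\<^sup>2)"
  using assms(2,3)
proof (induction "card S" arbitrary: S)
  case 0
  then show ?case by simp
next
  case (Suc k)
  have sym: "adj E a b = adj E b a" for a b using E[of a b] E[of b a] by (auto simp: adj_def)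
  have "S \<noteq> {}" using Suc.hyps(2) by auto
  have "vol E S \<le> d * card S" using Suc.prems by blast
  then obtain v where v: "v \<in> S" "deg_in E S v \<le> d"
    using ex_deg_in_le[OF \<open>finite S\<close> \<open>S \<noteq> {}\<close>] by blast
  define S' where "S' = S - {v}"
  have S': "finite S'" "card S' = k" using Suc.hyps(2) v(1) \<open>finite S\<close> by (simp_all add: S'_def)
  have split: "sum f S = f v + sum f S'" for f :: "'a \<Rightarrow> real"
    unfolding S'_def using \<open>finite S\<close> v(1) by (rule sum.remove)
  have "adj E v v = 0" using E[of v v] by (auto simp: adj_def)
  have IH: "(\<Sum>a\<in>S'. \<Sum>b\<in>S'. adj E a b * (\<bar>x a\<bar> * \<bar>x b\<bar>)) \<le>
    (\<Sum>a\<in>S'. (c * d + deg_in E S' a / c) * (x a)\<^sup>2)"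
  proof (rule Suc.hyps(1))
    show "k = card S'" "finite S'" using S' by simp_all
    show "vol E T \<le> d * card T" if "T \<subseteq> S'" for T
      using that by (intro Suc.prems(2)) (auto simp: S'_def)
  qed
  \<comment> \<open>Each edge at the removed v occurs in both orders, hence the factor 2. For it, v
    pays c times its squared entry and the other end pays 1/c times its own. As v has at most d
    neighbours left, it pays at most c d in all, while the shares 1/c add up to the degree term in
    the course of the induction.\<close>
  have amgm: "2 * (\<bar>x v\<bar> * \<bar>x b\<bar>) \<le> c * (x v)\<^sup>2 + (x b)\<^sup>2 / c" for b
  proof -
    have "0 \<le> (c * \<bar>x v\<bar> - \<bar>x b\<bar>)\<^sup>2" by simp
    then have "2 * c * (\<bar>x v\<bar> * \<bar>x b\<bar>) \<le> c * (c * (x v)\<^sup>2) + (x b)\<^sup>2"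
      by (simp add: power2_eq_square algebra_simps flip: abs_mult)
    then show ?thesis using c by (simp add: field_simps)
  qed
  have "(\<Sum>a\<in>S. \<Sum>b\<in>S. adj E a b * (\<bar>x a\<bar> * \<bar>x b\<bar>)) =
     (\<Sum>a\<in>S'. \<Sum>b\<in>S'. adj E a b * (\<bar>x a\<bar> * \<bar>x b\<bar>)) + (\<Sum>b\<in>S'. adj E v b * (2 * (\<bar>x v\<bar> * \<bar>x b\<bar>)))"
  proof -
    have "(\<Sum>a\<in>S'. adj E a v * (\<bar>x a\<bar> * \<bar>x v\<bar>)) = (\<Sum>b\<in>S'. adj E v b * (\<bar>x v\<bar> * \<bar>x b\<bar>))"
      by (intro sum.cong refl) (simp add: sym[of _ v] mult.commute)
    moreover have "(\<Sum>b\<in>S'. adj E v b * (2 * (\<bar>x v\<bar> * \<bar>x b\<bar>))) = 2 * (\<Sum>b\<in>S'. adj E v b * (\<bar>x v\<bar> * \<bar>x b\<bar>))"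
      by (simp only: sum_distrib_left mult.left_commute)
    ultimately show ?thesis
      unfolding split sum.distrib using \<open>adj E v v = 0\<close> by simp
  qed
  also have "\<dots> \<le> (\<Sum>a\<in>S'. (c * d + deg_in E S' a / c) * (x a)\<^sup>2)
     + (\<Sum>b\<in>S'. adj E v b * (c * (x v)\<^sup>2 + (x b)\<^sup>2 / c))"
    by (intro add_mono IH sum_mono mult_left_mono amgm) simp
  also have "(\<Sum>b\<in>S'. adj E v b * (c * (x v)\<^sup>2 + (x b)\<^sup>2 / c)) =
     c * (x v)\<^sup>2 * deg_in E S v + (\<Sum>b\<in>S'. adj E b v / c * (x b)\<^sup>2)"
  proof -
    have "adj E v b * (c * (x v)\<^sup>2 + (x b)\<^sup>2 / c) = c * (x v)\<^sup>2 * adj E v b + adj E b v / c * (x b)\<^sup>2" for b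
      by (simp add: sym[of b v] algebra_simps)
    then show ?thesis
      using \<open>adj E v v = 0\<close> by (simp add: real_deg_in split sum.distrib sum_distrib_left)
  qed
  also have "(\<Sum>a\<in>S'. (c * d + deg_in E S' a / c) * (x a)\<^sup>2)
     + (c * (x v)\<^sup>2 * deg_in E S v + (\<Sum>b\<in>S'. adj E b v / c * (x b)\<^sup>2))
     = c * (x v)\<^sup>2 * deg_in E S v + (\<Sum>a\<in>S'. (c * d + deg_in E S a / c) * (x a)\<^sup>2)"
  proof -
    have "(c * d + deg_in E S a / c) * (x a)\<^sup>2 =
       (c * d + deg_in E S' a / c) * (x a)\<^sup>2 + adj E a v / c * (x a)\<^sup>2" for a
      unfolding real_deg_in split by (simp add: add_divide_distrib algebra_simps)
    then show ?thesis by (simp add: sum.distrib)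
  qed
  also have "c * (x v)\<^sup>2 * deg_in E S v \<le> (c * d + deg_in E S v / c) * (x v)\<^sup>2"
  proof -
    have "c * real (deg_in E S v) \<le> c * d + deg_in E S v / c"
      using v(2) c by (intro add_increasing2) auto
    then have "c * real (deg_in E S v) * (x v)\<^sup>2 \<le> (c * d + deg_in E S v / c) * (x v)\<^sup>2"
      by (intro mult_right_mono) auto
    then show ?thesis by (simp add: mult_ac)
  qed
  finally show ?case by (simp add: split)
qed

text \<open>The spectral estimates see minor-freeness only through the last two assumptions: linear
  density of every vertex subset, and boundedly many common neighbours of s + 1 vertices.\<close>

locale sparse_graph =
  fixes E :: "nat \<Rightarrow> nat \<Rightarrow> bool" and V :: "nat set" and d s :: nat
  assumes E: "E a b \<Longrightarrow> E b a \<and> a \<noteq> b"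
    and finV: "finite V" "V \<noteq> {}" and s_pos: "s \<ge> 1" and d_pos: "d \<ge> 1"
    and sparse: "T \<subseteq> V \<Longrightarrow> vol E T \<le> d * card T"
    and few_common: "Q \<subseteq> V \<Longrightarrow> card Q = Suc s \<Longrightarrow> card {u \<in> V - Q. \<forall>l\<in>Q. E u l} \<le> Suc s"
begin

abbreviation "n \<equiv> card V"

text \<open>The threshold is matched to the weight c = \<gamma> sqrt n in the weighted AM-GM bound:
  below it, degree / c is at most c.\<close>

definition heavy :: "real \<Rightarrow> nat set" where
  "heavy \<gamma> = {v \<in> V. \<gamma>\<^sup>2 * n \<le> deg_in E V v}"

definition nb :: "real \<Rightarrow> nat \<Rightarrow> nat set" where
  "nb \<gamma> u = {l \<in> heavy \<gamma>. E u l}"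

definition good :: "real \<Rightarrow> nat set" where
  "good \<gamma> = {u \<in> V - heavy \<gamma>. card (nb \<gamma> u) \<le> s}"

definition bad :: "real \<Rightarrow> nat set" where
  "bad \<gamma> = {u \<in> V - heavy \<gamma>. card (nb \<gamma> u) > s}"

text \<open>At most d n ordered edges are available and each heavy vertex uses \<gamma>^2 n of them;
  n cancels.\<close>

definition heavy_bound :: "real \<Rightarrow> nat" where
  "heavy_bound \<gamma> = nat \<lfloor>d / \<gamma>\<^sup>2\<rfloor>"

text \<open>The square counts heavy-heavy pairs, the other term counts heavy-bad pairs in both
  orders. Entries of a unit vector are at most 1 in modulus, so these counts bound the corresponding
  parts of the form.\<close>

definition error_bound :: "real \<Rightarrow> real" where
  "error_bound \<gamma> = (real (heavy_bound \<gamma>))\<^sup>2 + 2 * (real (heavy_bound \<gamma>) * real (Suc s * 2 ^ heavy_bound \<gamma>))"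

section \<open>Counting heavy and bad vertices, and the leading part of the form\<close>

lemma n_pos: "n > 0" using finV by (simp add: card_gt_0_iff)

lemma adj_sym: "adj E a b = adj E b a"
  using E[of a b] E[of b a] by (auto simp: adj_def)

lemma heavy_subset: "heavy \<gamma> \<subseteq> V" by (auto simp: heavy_def)

lemma finite_heavy: "finite (heavy \<gamma>)" using heavy_subset finV(1) by (rule finite_subset)

lemma finite_nb: "finite (nb \<gamma> u)" using finite_heavy by (simp add: nb_def)

lemma card_heavy:
  assumes "\<gamma> > 0"
  shows "card (heavy \<gamma>) \<le> heavy_bound \<gamma>"
proof -
  have "card (heavy \<gamma>) * (\<gamma>\<^sup>2 * n) = (\<Sum>v\<in>heavy \<gamma>. \<gamma>\<^sup>2 * n)" by simp
  also have "\<dots> \<le> (\<Sum>v\<in>heavy \<gamma>. real (deg_in E V v))"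
    by (intro sum_mono) (simp add: heavy_def)
  also have "\<dots> \<le> (\<Sum>v\<in>V. real (deg_in E V v))"
    using heavy_subset finV(1) by (intro sum_mono2) auto
  also have "\<dots> = real (vol E V)" by (simp add: vol_def)
  also have "\<dots> \<le> d * real n" using sparse[of V] by (simp flip: of_nat_mult)
  finally have "(card (heavy \<gamma>) * \<gamma>\<^sup>2) * n \<le> d * real n" by (simp add: mult.assoc)
  then have "card (heavy \<gamma>) * \<gamma>\<^sup>2 \<le> d" using n_pos by simp
  then have "card (heavy \<gamma>) \<le> d / \<gamma>\<^sup>2" using assms by (simp add: pos_le_divide_eq)
  then show ?thesis unfolding heavy_bound_def by (simp add: le_nat_floor)
qed

text \<open>Every bad vertex is a common neighbour of some (s + 1)-set of heavy vertices. There are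
  at most 2 ^ \<open>heavy_bound \<gamma>\<close> such sets, and each has at most s + 1 common
  neighbours.\<close>

lemma card_bad:
  assumes "\<gamma> > 0"
  shows "card (bad \<gamma>) \<le> Suc s * 2 ^ heavy_bound \<gamma>"
proof -
  let ?Q = "{Q. Q \<subseteq> heavy \<gamma> \<and> card Q = Suc s}"
  let ?C = "\<lambda>Q. {u \<in> V - Q. \<forall>l\<in>Q. E u l}"
  have finQ: "finite ?Q" using finite_heavy by (intro finite_subset[of ?Q "Pow (heavy \<gamma>)"]) auto
  have "bad \<gamma> \<subseteq> (\<Union>Q\<in>?Q. ?C Q)"
  proof
    fix u assume u: "u \<in> bad \<gamma>"
    then have "Suc s \<le> card (nb \<gamma> u)" by (simp add: bad_def)
    then obtain Q where Q: "Q \<subseteq> nb \<gamma> u" "card Q = Suc s" by (rule obtain_subset_with_card_n)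
    then have "Q \<in> ?Q" "u \<in> ?C Q" using u by (auto simp: nb_def bad_def)
    then show "u \<in> (\<Union>Q\<in>?Q. ?C Q)" by blast
  qed
  moreover have "finite (\<Union>Q\<in>?Q. ?C Q)" by (rule finite_subset[OF _ finV(1)]) auto
  ultimately have "card (bad \<gamma>) \<le> card (\<Union>Q\<in>?Q. ?C Q)" by (rule card_mono[rotated])
  also have "\<dots> \<le> (\<Sum>Q\<in>?Q. card (?C Q))" by (rule card_UN_le[OF finQ])
  also have "\<dots> \<le> (\<Sum>Q\<in>?Q. Suc s)"
  proof (rule sum_mono)
    fix Q assume "Q \<in> ?Q"
    then show "card (?C Q) \<le> Suc s" using heavy_subset[of \<gamma>] by (intro few_common) auto
  qed
  also have "\<dots> = Suc s * card ?Q" by simp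
  also have "card ?Q \<le> 2 ^ heavy_bound \<gamma>"
  proof -
    have "card ?Q \<le> card (Pow (heavy \<gamma>))" using finite_heavy by (intro card_mono) auto
    also have "\<dots> \<le> 2 ^ heavy_bound \<gamma>" using card_heavy[OF assms] finite_heavy
      by (simp add: card_Pow power_increasing)
    finally show ?thesis .
  qed
  finally show ?thesis by (simp only: mult_le_cancel1) simp
qed

text \<open>The heavy part of the entry at u of the adjacency matrix applied to x. Its inner product
  with x over the good vertices is the leading term of the form.\<close>

definition pull :: "real \<Rightarrow> (nat \<Rightarrow> real) \<Rightarrow> nat \<Rightarrow> real" where
  "pull \<gamma> x u = (\<Sum>l\<in>heavy \<gamma>. adj E u l * x l)"

lemma pull_eq: "pull \<gamma> x u = (\<Sum>l\<in>nb \<gamma> u. x l)"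
  unfolding pull_def nb_def using finite_heavy by (rule sum_adj)

text \<open>Split V into heavy, good and bad vertices. The pairs between heavy and good ones are
  kept exactly; heavy-heavy and heavy-bad pairs are boundedly many, and pairs of light vertices are
  handled by the sparse-graph bound.\<close>

lemma form_bound:
  fixes x :: "nat \<Rightarrow> real"
  assumes \<gamma>: "\<gamma> > 0" and unit: "(\<Sum>i\<in>V. (x i)\<^sup>2) = 1"
  shows "\<bar>\<Sum>i\<in>V. \<Sum>j\<in>V. adj E i j * (x i * x j)\<bar> \<le>
    2 * \<bar>\<Sum>u\<in>good \<gamma>. x u * pull \<gamma> x u\<bar> + \<gamma> * (d + 1) * sqrt n + error_bound \<gamma>"
proof -
  define H R where "H = heavy \<gamma>" and "R = V - H"
  define h where "h = real (heavy_bound \<gamma>)"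
  have cardH: "real (card H) \<le> h" using card_heavy[OF \<gamma>] by (simp add: H_def h_def)
  have fin: "finite H" "finite R" "finite (good \<gamma>)" "finite (bad \<gamma>)"
    using finV(1) finite_heavy by (auto simp: H_def R_def good_def bad_def)
  have split: "sum f V = sum f H + sum f R" for f :: "nat \<Rightarrow> real"
    unfolding R_def using heavy_subset[of \<gamma>] finV(1) by (simp add: H_def sum.subset_diff add.commute)
  have R: "R = good \<gamma> \<union> bad \<gamma>" "good \<gamma> \<inter> bad \<gamma> = {}"
    by (auto simp: R_def H_def good_def bad_def)
  have splitR: "sum f R = sum f (good \<gamma>) + sum f (bad \<gamma>)" for f :: "nat \<Rightarrow> real"
    unfolding R(1) using fin R(2) by (intro sum.union_disjoint) auto
  have x1: "\<bar>x i\<bar> \<le> 1" if "i \<in> V" for i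
  proof -
    have "(x i)\<^sup>2 \<le> (\<Sum>i\<in>V. (x i)\<^sup>2)" using that finV(1) by (intro member_le_sum) auto
    then show ?thesis using unit by (simp add: abs_square_le_1)
  qed
  have HV: "i \<in> H \<Longrightarrow> i \<in> V" for i using heavy_subset by (auto simp: H_def)
  define q where "q A B = (\<Sum>i\<in>A. \<Sum>j\<in>B. adj E i j * (x i * x j))" for A B
  have RH: "q R H = (\<Sum>u\<in>R. x u * pull \<gamma> x u)"
    unfolding q_def pull_def H_def by (simp add: sum_distrib_left mult.left_commute)
  have HR: "q H R = q R H"
    unfolding q_def by (subst sum.swap) (simp add: adj_sym mult.commute)
  have "q V V = q H H + q H R + q R H + q R R"
    unfolding q_def split sum.distrib by simp
  then have "q V V = q H H + 2 * (\<Sum>u\<in>good \<gamma>. x u * pull \<gamma> x u)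
      + 2 * (\<Sum>u\<in>bad \<gamma>. x u * pull \<gamma> x u) + q R R"
    using HR RH by (simp add: splitR)
  moreover have "\<bar>q H H\<bar> \<le> h\<^sup>2"
  proof -
    have "\<bar>q H H\<bar> \<le> (\<Sum>i\<in>H. \<Sum>j\<in>H. 1)"
      unfolding q_def
    proof (intro sum_abs[THEN order_trans] sum_mono)
      fix i j assume "i \<in> H" "j \<in> H"
      then show "\<bar>adj E i j * (x i * x j)\<bar> \<le> 1"
        using x1[of i] x1[of j] HV adj_le_1[of E i j] by (auto simp: abs_mult intro!: mult_le_one)
    qed
    also have "\<dots> = (real (card H))\<^sup>2" by (simp add: power2_eq_square)
    also have "\<dots> \<le> h\<^sup>2" using cardH by (intro power_mono) auto
    finally show ?thesis .
  qed
  moreover have "\<bar>\<Sum>u\<in>bad \<gamma>. x u * pull \<gamma> x u\<bar> \<le> h * real (Suc s * 2 ^ heavy_bound \<gamma>)"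
  proof -
    have "\<bar>\<Sum>u\<in>bad \<gamma>. x u * pull \<gamma> x u\<bar> \<le> (\<Sum>u\<in>bad \<gamma>. h)"
    proof (intro sum_abs[THEN order_trans] sum_mono)
      fix u assume "u \<in> bad \<gamma>"
      then have "u \<in> V" by (simp add: bad_def)
      have "\<bar>pull \<gamma> x u\<bar> \<le> (\<Sum>l\<in>H. 1)"
        unfolding pull_def H_def[symmetric]
      proof (intro sum_abs[THEN order_trans] sum_mono)
        fix l assume "l \<in> H"
        then show "\<bar>adj E u l * x l\<bar> \<le> 1"
          using x1[of l] HV adj_le_1[of E u l] by (auto simp: abs_mult intro!: mult_le_one)
      qed
      then have "\<bar>pull \<gamma> x u\<bar> \<le> h" using cardH by simp
      then show "\<bar>x u * pull \<gamma> x u\<bar> \<le> h"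
        using x1[OF \<open>u \<in> V\<close>] mult_mono[of "\<bar>x u\<bar>" 1 "\<bar>pull \<gamma> x u\<bar>" h] by (simp add: abs_mult)
    qed
    also have "\<dots> = h * real (card (bad \<gamma>))" by simp
    also have "\<dots> \<le> h * real (Suc s * 2 ^ heavy_bound \<gamma>)"
      using card_bad[OF \<gamma>] unfolding h_def by (intro mult_left_mono of_nat_mono) auto
    finally show ?thesis .
  qed
  moreover have "\<bar>q R R\<bar> \<le> \<gamma> * (d + 1) * sqrt n"
  proof -
    \<comment> \<open>Lightness gives degree / c \<le> c, so the cost per vertex is at most c (d +
      1).\<close>
    define c where "c = \<gamma> * sqrt n"
    have c: "c > 0" using \<gamma> n_pos by (simp add: c_def)
    have "\<bar>q R R\<bar> \<le> (\<Sum>i\<in>R. \<Sum>j\<in>R. adj E i j * (\<bar>x i\<bar> * \<bar>x j\<bar>))"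
      unfolding q_def
    proof (intro sum_abs[THEN order_trans] sum_mono)
      fix i j show "\<bar>adj E i j * (x i * x j)\<bar> \<le> adj E i j * (\<bar>x i\<bar> * \<bar>x j\<bar>)"
        by (simp add: abs_mult)
    qed
    also have "\<dots> \<le> (\<Sum>a\<in>R. (c * d + deg_in E R a / c) * (x a)\<^sup>2)"
    proof (rule adjacency_form_bound[OF E fin(2) _ c])
      show "vol E T \<le> d * card T" if "T \<subseteq> R" for T
        using that by (intro sparse) (auto simp: R_def)
    qed
    also have "\<dots> \<le> (\<Sum>a\<in>R. (\<gamma> * (d + 1) * sqrt n) * (x a)\<^sup>2)"
    proof (intro sum_mono mult_right_mono)
      fix a assume a: "a \<in> R"
      have "deg_in E R a \<le> deg_in E V a"
        unfolding deg_in_def using finV(1) by (intro sum_mono2) (auto simp: R_def)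
      moreover have "real (deg_in E V a) \<le> \<gamma>\<^sup>2 * n" using a by (auto simp: R_def H_def heavy_def)
      ultimately have "real (deg_in E R a) \<le> c * c"
        using n_pos by (simp add: c_def flip: power2_eq_square) (simp add: power_mult_distrib)
      then have "deg_in E R a / c \<le> c" using c by (simp add: pos_divide_le_eq)
      then show "c * d + deg_in E R a / c \<le> \<gamma> * (d + 1) * sqrt n"
        by (simp add: c_def algebra_simps)
    qed simp
    also have "\<dots> = (\<gamma> * (d + 1) * sqrt n) * (\<Sum>a\<in>R. (x a)\<^sup>2)" by (simp only: sum_distrib_left)
    also have "\<dots> \<le> (\<gamma> * (d + 1) * sqrt n) * 1"
    proof (rule mult_left_mono)
      have "(\<Sum>a\<in>H. (x a)\<^sup>2) \<ge> 0" by (simp add: sum_nonneg)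
      then show "(\<Sum>a\<in>R. (x a)\<^sup>2) \<le> 1" using unit unfolding split by linarith
    qed (use \<gamma> in simp)
    finally show ?thesis by simp
  qed
  ultimately show ?thesis unfolding q_def[symmetric] error_bound_def h_def[symmetric] by linarith
qed

end

section \<open>Concentration of extremal eigenvectors\<close>

context sparse_graph begin

lemma pull_sq_le:
  fixes x :: "nat \<Rightarrow> real"
  assumes "u \<in> good \<gamma>"
  shows "(pull \<gamma> x u)\<^sup>2 \<le> s * (\<Sum>l\<in>heavy \<gamma>. (x l)\<^sup>2)"
    and "(pull \<gamma> x u)\<^sup>2 \<le> card (nb \<gamma> u) * (\<Sum>l\<in>heavy \<gamma>. (x l)\<^sup>2)"
proof -
  let ?\<mu> = "\<Sum>l\<in>heavy \<gamma>. (x l)\<^sup>2"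
  have "(pull \<gamma> x u)\<^sup>2 \<le> (\<Sum>l\<in>nb \<gamma> u. (x l)\<^sup>2) * card (nb \<gamma> u)"
    unfolding pull_eq by (rule sum_squared_le_sum_of_squares)
  also have "\<dots> \<le> ?\<mu> * card (nb \<gamma> u)"
    using finite_heavy by (intro mult_right_mono sum_mono2) (auto simp: nb_def)
  finally show 1: "(pull \<gamma> x u)\<^sup>2 \<le> card (nb \<gamma> u) * ?\<mu>" by (simp add: mult.commute)
  have "real (card (nb \<gamma> u)) * ?\<mu> \<le> s * ?\<mu>"
    using assms by (intro mult_right_mono) (auto simp: good_def intro: sum_nonneg)
  with 1 show "(pull \<gamma> x u)\<^sup>2 \<le> s * ?\<mu>" by linarith
qed

text \<open>A unit vector with mass \<mu> on the heavy vertices has at most 1 - \<mu> on the good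
  ones. Chained together, the estimates bound the squared leading term by \<mu> (1 - \<mu>) s n
  \<le> s n / 4, so twice that term is at most sqrt (s n) in modulus.\<close>

lemma pull_form_le:
  fixes x :: "nat \<Rightarrow> real"
  assumes unit: "(\<Sum>i\<in>V. (x i)\<^sup>2) = 1"
  shows "(\<Sum>l\<in>heavy \<gamma>. (x l)\<^sup>2) \<le> 1"
    and "(\<Sum>u\<in>good \<gamma>. (pull \<gamma> x u)\<^sup>2) \<le> s * n * (\<Sum>l\<in>heavy \<gamma>. (x l)\<^sup>2)"
    and "(\<Sum>u\<in>good \<gamma>. x u * pull \<gamma> x u)\<^sup>2
      \<le> (1 - (\<Sum>l\<in>heavy \<gamma>. (x l)\<^sup>2)) * (\<Sum>u\<in>good \<gamma>. (pull \<gamma> x u)\<^sup>2)"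
proof -
  define \<mu> where "\<mu> = (\<Sum>l\<in>heavy \<gamma>. (x l)\<^sup>2)"
  define B where "B = (\<Sum>u\<in>good \<gamma>. (pull \<gamma> x u)\<^sup>2)"
  define g where "g = (\<Sum>u\<in>good \<gamma>. x u * pull \<gamma> x u)"
  have "\<mu> \<ge> 0" unfolding \<mu>_def by (simp add: sum_nonneg)
  have VV: "1 = \<mu> + (\<Sum>i\<in>V - heavy \<gamma>. (x i)\<^sup>2)"
    using unit sum.subset_diff[OF heavy_subset finV(1), of "\<lambda>l. (x l)\<^sup>2" \<gamma>] by (simp add: \<mu>_def)
  have "(\<Sum>u\<in>good \<gamma>. (x u)\<^sup>2) \<le> (\<Sum>i\<in>V - heavy \<gamma>. (x i)\<^sup>2)"
    using finV(1) by (intro sum_mono2) (auto simp: good_def)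
  then have xg: "(\<Sum>u\<in>good \<gamma>. (x u)\<^sup>2) \<le> 1 - \<mu>" using VV by simp
  have "\<mu> \<le> 1" using VV sum_nonneg[of "V - heavy \<gamma>" "\<lambda>i. (x i)\<^sup>2"] by simp
  have "B \<ge> 0" unfolding B_def by (simp add: sum_nonneg)
  have cg: "card (good \<gamma>) \<le> n" using finV(1) by (intro card_mono) (auto simp: good_def)
  have "B \<le> (\<Sum>u\<in>good \<gamma>. s * \<mu>)" unfolding B_def \<mu>_def by (intro sum_mono pull_sq_le(1))
  also have "\<dots> \<le> n * (s * \<mu>)" using cg \<open>\<mu> \<ge> 0\<close> by (simp add: mult_right_mono)
  finally have B: "B \<le> s * n * \<mu>" by (simp add: mult_ac)
  have "g\<^sup>2 \<le> (\<Sum>u\<in>good \<gamma>. (x u)\<^sup>2) * B"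
    unfolding g_def B_def by (rule Cauchy_Schwarz_ineq_sum)
  also have "\<dots> \<le> (1 - \<mu>) * B" using xg \<open>B \<ge> 0\<close> by (rule mult_right_mono)
  finally have g2: "g\<^sup>2 \<le> (1 - \<mu>) * B" .
  from \<open>\<mu> \<le> 1\<close> B g2
  show "(\<Sum>l\<in>heavy \<gamma>. (x l)\<^sup>2) \<le> 1"
    "(\<Sum>u\<in>good \<gamma>. (pull \<gamma> x u)\<^sup>2) \<le> s * n * (\<Sum>l\<in>heavy \<gamma>. (x l)\<^sup>2)"
    "(\<Sum>u\<in>good \<gamma>. x u * pull \<gamma> x u)\<^sup>2
      \<le> (1 - (\<Sum>l\<in>heavy \<gamma>. (x l)\<^sup>2)) * (\<Sum>u\<in>good \<gamma>. (pull \<gamma> x u)\<^sup>2)"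
    unfolding \<mu>_def B_def g_def by blast+
qed

text \<open>With \<open>m\<close> the mean of \<open>x\<close> over an \<open>s\<close>-set of neighbours, the deviation of \<open>x\<close> on the heavy
  vertices from \<open>m\<close> times the indicator of these neighbours is controlled by the Cauchy-Schwarz
  defect of \<open>pull \<gamma> x u\<close>.\<close>

lemma pull_deviation:
  fixes x :: "nat \<Rightarrow> real" and \<mu> \<theta> m :: real
  assumes u: "u \<in> good \<gamma>" and \<mu>: "\<mu> = (\<Sum>l\<in>heavy \<gamma>. (x l)\<^sup>2)"
    and near: "(1 - \<theta>) * (s * \<mu>) \<le> (pull \<gamma> x u)\<^sup>2" and m: "m = pull \<gamma> x u / s"
  shows "l \<in> nb \<gamma> u \<Longrightarrow> (x l - m)\<^sup>2 \<le> \<theta> * \<mu>"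
    and "l \<in> heavy \<gamma> - nb \<gamma> u \<Longrightarrow> (x l)\<^sup>2 \<le> \<theta> * \<mu>"
proof -
  let ?N = "nb \<gamma> u" and ?M = "heavy \<gamma> - nb \<gamma> u"
  have sub: "?N \<subseteq> heavy \<gamma>" by (auto simp: nb_def)
  have fin: "finite ?N" "finite ?M" using finite_heavy finite_nb by auto
  have pull: "pull \<gamma> x u = s * m" using m s_pos by simp
  have "(\<Sum>l\<in>?N. (x l - m)\<^sup>2) = (\<Sum>l\<in>?N. (x l)\<^sup>2) - 2 * m * (\<Sum>l\<in>?N. x l) + card ?N * m\<^sup>2"
    unfolding sum_distrib_left by (simp add: power2_diff sum.distrib sum_subtractf mult_ac)
  also have "\<dots> = (\<Sum>l\<in>?N. (x l)\<^sup>2) - 2 * m * (s * m) + card ?N * m\<^sup>2"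
    by (simp only: pull_eq[symmetric] pull)
  \<comment> \<open>\<open>m\<close> divides by s even if u has fewer heavy neighbours; replacing
    their number by s only enlarges the bound.\<close>
  also have "\<dots> \<le> (\<Sum>l\<in>?N. (x l)\<^sup>2) - 2 * m * (s * m) + s * m\<^sup>2"
    using u by (intro add_left_mono mult_right_mono) (auto simp: good_def)
  also have "\<dots> = (\<Sum>l\<in>?N. (x l)\<^sup>2) - s * m\<^sup>2" by (simp add: power2_eq_square)
  finally have "(\<Sum>l\<in>?N. (x l - m)\<^sup>2) + (\<Sum>l\<in>?M. (x l)\<^sup>2) \<le> \<mu> - s * m\<^sup>2"
    using sum.subset_diff[OF sub finite_heavy, of "\<lambda>l. (x l)\<^sup>2"] by (simp add: \<mu>)
  moreover have "(1 - \<theta>) * \<mu> \<le> s * m\<^sup>2"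
  proof -
    have "s * ((1 - \<theta>) * \<mu>) \<le> s * (s * m\<^sup>2)"
      using near by (simp add: pull power_mult_distrib power2_eq_square mult_ac)
    then show ?thesis using s_pos by simp
  qed
  ultimately have tot: "(\<Sum>l\<in>?N. (x l - m)\<^sup>2) + (\<Sum>l\<in>?M. (x l)\<^sup>2) \<le> \<theta> * \<mu>"
    by (simp add: left_diff_distrib)
  show "(x l - m)\<^sup>2 \<le> \<theta> * \<mu>" if "l \<in> ?N"
    using member_le_sum[of l ?N "\<lambda>l. (x l - m)\<^sup>2"] that fin tot sum_nonneg[of ?M "\<lambda>l. (x l)\<^sup>2"] by simp
  show "(x l)\<^sup>2 \<le> \<theta> * \<mu>" if "l \<in> ?M"
    using member_le_sum[of l ?M "\<lambda>l. (x l)\<^sup>2"] that fin tot sum_nonneg[of ?N "\<lambda>l. (x l - m)\<^sup>2"] by simp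
qed

text \<open>The leading term is limited by 4 \<mu> (1 - \<mu>) \<le> 1 and by pull^2 \<le> s \<mu>
  at each good vertex. When it is nearly maximal, the second estimate is nearly tight for at least
  three quarters of all vertices, and all of these have the same heavy neighbours.\<close>

lemma concentration:
  fixes x :: "nat \<Rightarrow> real"
  assumes unit: "(\<Sum>i\<in>V. (x i)\<^sup>2) = 1"
    and \<delta>: "0 < \<delta>" "\<delta> \<le> 1/4" and \<theta>: "\<theta> = \<delta>\<^sup>2 / (2 * s)" and \<eta>: "\<eta> = \<theta> / 8"
    and big: "(1 - \<eta>) * sqrt (s * n) \<le> 2 * \<bar>\<Sum>u\<in>good \<gamma>. x u * pull \<gamma> x u\<bar>"
  obtains L m where "card L = s" "L \<subseteq> heavy \<gamma>" "m\<^sup>2 \<ge> 1 / (8 * s)"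
    "\<And>l. l \<in> L \<Longrightarrow> \<bar>x l - m\<bar> \<le> \<delta> * \<bar>m\<bar>" "\<And>l. l \<in> heavy \<gamma> - L \<Longrightarrow> \<bar>x l\<bar> \<le> \<delta> * \<bar>m\<bar>"
    "4 * card {u \<in> good \<gamma>. nb \<gamma> u = L} \<ge> 3 * n"
proof -
  define \<mu> where "\<mu> = (\<Sum>l\<in>heavy \<gamma>. (x l)\<^sup>2)"
  define B where "B = (\<Sum>u\<in>good \<gamma>. (pull \<gamma> x u)\<^sup>2)"
  define g where "g = (\<Sum>u\<in>good \<gamma>. x u * pull \<gamma> x u)"
  have fin: "finite (good \<gamma>)" using finV(1) by (simp add: good_def)
  have s: "real s \<ge> 1" using s_pos by simp
  have \<delta>2: "\<delta>\<^sup>2 \<le> 1/16" using power_mono[of \<delta> "1/4" 2] \<delta> by (simp add: power2_eq_square)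
  have "\<theta> \<le> \<delta>\<^sup>2 / 2" unfolding \<theta> using s by (intro divide_left_mono) auto
  then have \<theta>1: "0 < \<theta>" "\<theta> \<le> 1/32" using \<delta> \<delta>2 s by (auto simp: \<theta>)
  have \<theta>s: "\<theta> * s < 1" using \<delta>2 s by (simp add: \<theta>)
  have \<eta>1: "0 < \<eta>" "\<eta> \<le> 1/256" using \<theta>1 by (simp_all add: \<eta>)
  have "\<mu> \<ge> 0" unfolding \<mu>_def by (simp add: sum_nonneg)
  have ns: "0 < real (s * n)" using s n_pos by simp
  note pull_form = pull_form_le[OF unit, of \<gamma>, folded \<mu>_def B_def g_def]
  have "\<mu> \<le> 1" and B: "B \<le> s * n * \<mu>" and g2: "g\<^sup>2 \<le> (1 - \<mu>) * B"
    using pull_form by blast+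
  have "B \<ge> 0" unfolding B_def by (simp add: sum_nonneg)
  have cg: "card (good \<gamma>) \<le> n" using finV(1) by (intro card_mono) (auto simp: good_def)
  have "((1 - \<eta>) * sqrt (s * n))\<^sup>2 \<le> (2 * \<bar>g\<bar>)\<^sup>2"
    using big \<eta>1 unfolding g_def[symmetric] by (intro power_mono) auto
  then have "(1 - \<eta>)\<^sup>2 * (s * n) \<le> 4 * g\<^sup>2" by (simp add: power_mult_distrib)
  moreover have "(1 - 2 * \<eta>) * (s * n) \<le> (1 - \<eta>)\<^sup>2 * (s * n)"
    by (intro mult_right_mono) (simp_all add: power2_eq_square algebra_simps)
  ultimately have main: "(1 - 2 * \<eta>) * (s * n) \<le> 4 * ((1 - \<mu>) * B)" using g2 by linarith
  \<comment> \<open>Multiplying \<open>main\<close> by \<mu> and using 4 \<mu> (1 - \<mu>) \<le> 1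
    shows that B nearly attains its upper bound s n \<mu>.\<close>
  have \<mu>B: "(1 - 2 * \<eta>) * (s * n) * \<mu> \<le> B"
  proof -
    have "(1 - 2 * \<eta>) * (s * n) * \<mu> \<le> 4 * ((1 - \<mu>) * B) * \<mu>"
      using main \<open>\<mu> \<ge> 0\<close> by (rule mult_right_mono)
    also have "\<dots> = 4 * \<mu> * (1 - \<mu>) * B" by simp
    also have "\<dots> \<le> 1 * B"
    proof (rule mult_right_mono)
      have "0 \<le> (2 * \<mu> - 1)\<^sup>2" by simp
      then show "4 * \<mu> * (1 - \<mu>) \<le> 1" by (simp add: power2_eq_square algebra_simps)
    qed fact
    finally show ?thesis by simp
  qed
  \<comment> \<open>A crude bound (\<mu> is in fact near 1/2) that permits division by \<mu> and
    keeps m away from 0.\<close>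
  have \<mu>14: "\<mu> \<ge> (1 - 2 * \<eta>) / 4"
  proof -
    have "(1 - 2 * \<eta>) * (s * n) \<le> 4 * ((1 - \<mu>) * (s * n * \<mu>))"
      using main mult_left_mono[OF B, of "1 - \<mu>"] \<open>\<mu> \<le> 1\<close> by linarith
    also have "\<dots> = (4 * ((1 - \<mu>) * \<mu>)) * (s * n)" by simp
    finally have "1 - 2 * \<eta> \<le> 4 * ((1 - \<mu>) * \<mu>)" using ns by (simp only: mult_le_cancel_right_pos)
    also have "(1 - \<mu>) * \<mu> \<le> 1 * \<mu>" using \<open>\<mu> \<ge> 0\<close> by (intro mult_right_mono) auto
    finally show ?thesis by simp
  qed
  then have "\<mu> > 0" using \<eta>1 by simp
  then have s\<mu>: "s * \<mu> > 0" using s by simp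
  define G where "G = {u \<in> good \<gamma>. (1 - \<theta>) * (s * \<mu>) \<le> (pull \<gamma> x u)\<^sup>2}"
  have G: "G \<subseteq> good \<gamma>" by (auto simp: G_def)
  have finG: "finite G" using G fin by (rule finite_subset)
  have cG: "4 * card G \<ge> 3 * n"
  proof -
    have "B = (\<Sum>u\<in>good \<gamma> - G. (pull \<gamma> x u)\<^sup>2) + (\<Sum>u\<in>G. (pull \<gamma> x u)\<^sup>2)"
      unfolding B_def using G fin by (rule sum.subset_diff)
    also have "\<dots> \<le> (\<Sum>u\<in>good \<gamma> - G. (1 - \<theta>) * (s * \<mu>)) + (\<Sum>u\<in>G. s * \<mu>)"
    proof (intro add_mono sum_mono)
      show "(pull \<gamma> x u)\<^sup>2 \<le> (1 - \<theta>) * (s * \<mu>)" if "u \<in> good \<gamma> - G" for u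
        using that by (auto simp: G_def)
      show "(pull \<gamma> x u)\<^sup>2 \<le> s * \<mu>" if "u \<in> G" for u
        using that G pull_sq_le(1)[of u \<gamma> x] by (auto simp: \<mu>_def)
    qed
    also have "\<dots> = (s * \<mu>) * ((1 - \<theta>) * card (good \<gamma> - G) + card G)" by (simp add: algebra_simps)
    finally have "(1 - 2 * \<eta>) * (s * n) * \<mu> \<le> (s * \<mu>) * ((1 - \<theta>) * card (good \<gamma> - G) + card G)"
      using \<mu>B by linarith
    then have "(s * \<mu>) * ((1 - 2 * \<eta>) * n) \<le> (s * \<mu>) * ((1 - \<theta>) * card (good \<gamma> - G) + card G)"
      by (simp add: mult_ac)
    then have 1: "(1 - 2 * \<eta>) * n \<le> (1 - \<theta>) * card (good \<gamma> - G) + card G"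
      using s\<mu> by (simp only: mult_le_cancel_left_pos)
    have "card (good \<gamma> - G) = card (good \<gamma>) - card G" using G finG by (simp add: card_Diff_subset)
    moreover have "card G \<le> card (good \<gamma>)" using G fin by (simp add: card_mono)
    ultimately have "real (card (good \<gamma> - G)) \<le> real n - card G" using cg by simp
    then have "(1 - \<theta>) * card (good \<gamma> - G) \<le> (1 - \<theta>) * (real n - card G)"
      using \<theta>1 by (intro mult_left_mono) auto
    with 1 have "(1 - 2 * \<eta>) * n \<le> (1 - \<theta>) * (real n - card G) + card G" by linarith
    \<comment> \<open>A vertex outside \<open>G\<close> loses at least the share \<theta>, and the
      total loss is 2 \<eta> = \<theta> / 4, so at most n / 4 vertices lie outside
      \<open>G\<close>.\<close>
    then have "\<theta> * (3 * n) \<le> \<theta> * (4 * real (card G))" by (simp add: \<eta> algebra_simps)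
    then have "3 * real n \<le> 4 * real (card G)" using \<theta>1(1) by (simp only: mult_le_cancel_left_pos)
    then show ?thesis by linarith
  qed
  then have "G \<noteq> {}" using n_pos by auto
  then obtain u0 where u0: "u0 \<in> G" by blast
  have mean: "(pull \<gamma> x u / s)\<^sup>2 \<le> \<mu> / s" "(1 - \<theta>) * \<mu> / s \<le> (pull \<gamma> x u / s)\<^sup>2" if "u \<in> G" for u
  proof -
    have "(pull \<gamma> x u)\<^sup>2 / (s * s) \<le> (s * \<mu>) / (s * s)"
      using that G pull_sq_le(1)[of u \<gamma> x] by (intro divide_right_mono) (auto simp: \<mu>_def)
    then show "(pull \<gamma> x u / s)\<^sup>2 \<le> \<mu> / s" using s by (simp add: power_divide power2_eq_square)
    have "((1 - \<theta>) * (s * \<mu>)) / (s * s) \<le> (pull \<gamma> x u)\<^sup>2 / (s * s)"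
      using that by (intro divide_right_mono) (auto simp: G_def)
    then show "(1 - \<theta>) * \<mu> / s \<le> (pull \<gamma> x u / s)\<^sup>2" using s by (simp add: power_divide power2_eq_square)
  qed
  have dev: "(l \<in> nb \<gamma> u \<longrightarrow> \<bar>x l - pull \<gamma> x u / s\<bar> \<le> \<delta> * \<bar>pull \<gamma> x u / s\<bar>) \<and>
      (l \<in> heavy \<gamma> - nb \<gamma> u \<longrightarrow> \<bar>x l\<bar> \<le> \<delta> * \<bar>pull \<gamma> x u / s\<bar>)" if u: "u \<in> G" for u l
  proof -
    define m where "m = pull \<gamma> x u / s"
    have ug: "u \<in> good \<gamma>" and near: "(1 - \<theta>) * (s * \<mu>) \<le> (pull \<gamma> x u)\<^sup>2" using u by (auto simp: G_def)
    \<comment> \<open>This is the origin of \<theta> = \<delta>^2 / (2 s): m^2 is at least (1 -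
      \<theta>) \<mu> / s, and 2 (1 - \<theta>) \<ge> 1.\<close>
    have "\<theta> * \<mu> \<le> \<delta>\<^sup>2 * ((1 - \<theta>) * \<mu> / s)"
    proof -
      have "\<delta>\<^sup>2 * ((1 - \<theta>) * \<mu> / s) = 2 * \<theta> * ((1 - \<theta>) * \<mu>)" using s by (simp add: \<theta>)
      moreover have "\<theta> * \<mu> * 1 \<le> \<theta> * \<mu> * (2 * (1 - \<theta>))"
        using \<theta>1 \<open>\<mu> > 0\<close> by (intro mult_left_mono) auto
      ultimately show ?thesis by (simp add: mult_ac)
    qed
    also have "\<dots> \<le> \<delta>\<^sup>2 * m\<^sup>2" using mean(2)[OF u] by (intro mult_left_mono) (auto simp: m_def)
    finally have le: "\<theta> * \<mu> \<le> (\<delta> * \<bar>m\<bar>)\<^sup>2" by (simp add: power_mult_distrib)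
    have sq: "\<bar>y\<bar> \<le> \<delta> * \<bar>m\<bar>" if "y\<^sup>2 \<le> \<theta> * \<mu>" for y
    proof (rule power2_le_imp_le)
      show "\<bar>y\<bar>\<^sup>2 \<le> (\<delta> * \<bar>m\<bar>)\<^sup>2" using that le by simp
    qed (use \<delta> in simp)
    show ?thesis
      using sq[OF pull_deviation(1)[OF ug \<mu>_def near m_def]]
        sq[OF pull_deviation(2)[OF ug \<mu>_def near m_def]] by (simp add: m_def)
  qed
  have nz: "pull \<gamma> x u / s \<noteq> 0" if "u \<in> G" for u
  proof
    assume zero: "pull \<gamma> x u / s = 0"
    have "(1 - \<theta>) * \<mu> / s \<le> 0" using mean(2)[OF that] unfolding zero by simp
    moreover have "(1 - \<theta>) * \<mu> / s > 0" using \<theta>1 \<open>\<mu> > 0\<close> s by simp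
    ultimately show False by simp
  qed
  \<comment> \<open>The values m for u and v differ in modulus by a factor of at most 2. A vertex of
    nb u outside nb v would have an entry of modulus at least (1 - \<delta>) |m| and at most 2
    \<delta> |m|, which \<delta> \<le> 1/4 forbids.\<close>
  have sub: "nb \<gamma> u \<subseteq> nb \<gamma> v" if u: "u \<in> G" and v: "v \<in> G" for u v
  proof
    fix l assume l: "l \<in> nb \<gamma> u"
    define m k where "m = \<bar>pull \<gamma> x u / s\<bar>" and "k = \<bar>pull \<gamma> x v / s\<bar>"
    show "l \<in> nb \<gamma> v"
    proof (rule ccontr)
      assume "l \<notin> nb \<gamma> v"
      moreover have "l \<in> heavy \<gamma>" using l by (simp add: nb_def)
      ultimately have 1: "\<bar>x l\<bar> \<le> \<delta> * k" using dev[OF v, of l] by (simp add: k_def)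
      have "\<bar>x l - pull \<gamma> x u / s\<bar> \<le> \<delta> * m" using dev[OF u, of l] l by (simp add: m_def)
      then have 2: "(1 - \<delta>) * m \<le> \<bar>x l\<bar>" unfolding m_def left_diff_distrib by linarith
      have "m > 0" using nz[OF u] by (simp add: m_def)
      have "k\<^sup>2 \<le> \<mu> / s" using mean(1)[OF v] by (simp only: k_def power2_abs)
      also have "\<dots> \<le> 2 * ((1 - \<theta>) * \<mu> / s)"
      proof -
        have "1 * (\<mu> / s) \<le> 2 * (1 - \<theta>) * (\<mu> / s)"
          using \<theta>1 \<open>\<mu> > 0\<close> by (intro mult_right_mono) auto
        then show ?thesis by (simp only: mult_1 mult.assoc times_divide_eq_right)
      qed
      also have "\<dots> \<le> (2 * m)\<^sup>2"
      proof -
        have "(1 - \<theta>) * \<mu> / s \<le> m\<^sup>2" using mean(2)[OF u] by (simp only: m_def power2_abs)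
        moreover have "(2 * m)\<^sup>2 = 4 * m\<^sup>2" "0 \<le> m\<^sup>2" by (simp_all add: power_mult_distrib)
        ultimately show ?thesis by linarith
      qed
      finally have "k\<^sup>2 \<le> (2 * m)\<^sup>2" .
      then have "k \<le> 2 * m" by (rule power2_le_imp_le) (use \<open>m > 0\<close> in simp)
      then have "\<delta> * k \<le> \<delta> * (2 * m)" using \<delta> by (intro mult_left_mono) auto
      then have "(1 - \<delta>) * m \<le> 2 * \<delta> * m" using 1 2 by linarith
      then have "1 - \<delta> \<le> 2 * \<delta>" using \<open>m > 0\<close> by (simp only: mult_le_cancel_right_pos)
      then show False using \<delta> by simp
    qed
  qed
  have "nb \<gamma> u = nb \<gamma> u0" if "u \<in> G" for u using sub[OF that u0] sub[OF u0 that] by blast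
  then have "G \<subseteq> {u \<in> good \<gamma>. nb \<gamma> u = nb \<gamma> u0}" using G by blast
  then have "card G \<le> card {u \<in> good \<gamma>. nb \<gamma> u = nb \<gamma> u0}" using fin by (intro card_mono) auto
  then have c: "4 * card {u \<in> good \<gamma>. nb \<gamma> u = nb \<gamma> u0} \<ge> 3 * n" using cG by linarith
  \<comment> \<open>\<theta> s < 1 leaves less than one vertex of slack, so integrality makes the
    count exact.\<close>
  have cs: "card (nb \<gamma> u0) = s"
  proof -
    have "(1 - \<theta>) * (s * \<mu>) \<le> card (nb \<gamma> u0) * \<mu>"
      using u0 pull_sq_le(2)[of u0 \<gamma> x] by (auto simp: G_def \<mu>_def)
    then have "((1 - \<theta>) * s) * \<mu> \<le> card (nb \<gamma> u0) * \<mu>" by (simp add: mult_ac)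
    then have "(1 - \<theta>) * s \<le> card (nb \<gamma> u0)" using \<open>\<mu> > 0\<close> by (simp only: mult_le_cancel_right_pos)
    then have "real s < card (nb \<gamma> u0) + 1" using \<theta>s by (simp add: left_diff_distrib)
    moreover have "card (nb \<gamma> u0) \<le> s" using u0 G by (auto simp: good_def)
    ultimately show ?thesis by linarith
  qed
  have lower: "(pull \<gamma> x u0 / s)\<^sup>2 \<ge> 1 / (8 * s)"
  proof -
    have "1/8 \<le> (1 - \<theta>) * \<mu>"
    proof -
      have "(31/32) * (63/256) \<le> (1 - \<theta>) * \<mu>"
        using \<theta>1 \<mu>14 \<eta>1 by (intro mult_mono) auto
      then show ?thesis by simp
    qed
    then have "(1/8) / s \<le> (1 - \<theta>) * \<mu> / s" by (intro divide_right_mono) auto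
    then show ?thesis using mean(2)[OF u0] by simp
  qed
  have "nb \<gamma> u0 \<subseteq> heavy \<gamma>" by (auto simp: nb_def)
  from that[OF cs this lower dev[OF u0, THEN conjunct1, rule_format]
      dev[OF u0, THEN conjunct2, rule_format] c]
  show ?thesis .
qed

section \<open>From the quadratic form to the two extreme eigenvectors\<close>

lemma eigenvector_form:
  fixes x :: "nat \<Rightarrow> real"
  assumes unit: "(\<Sum>i\<in>V. (x i)\<^sup>2) = 1"
    and ev: "\<And>i. i \<in> V \<Longrightarrow> (\<Sum>j\<in>V. adj E i j * x j) = \<rho> * x i"
  shows "(\<Sum>i\<in>V. \<Sum>j\<in>V. adj E i j * (x i * x j)) = \<rho>"
proof -
  have "(\<Sum>i\<in>V. \<Sum>j\<in>V. adj E i j * (x i * x j)) = (\<Sum>i\<in>V. x i * (\<Sum>j\<in>V. adj E i j * x j))"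
    by (simp add: sum_distrib_left mult.left_commute)
  also have "\<dots> = (\<Sum>i\<in>V. \<rho> * (x i)\<^sup>2)"
    by (intro sum.cong refl) (simp add: ev power2_eq_square)
  finally show ?thesis using unit by (simp flip: sum_distrib_left)
qed

text \<open>By \<open>err\<close> the bounded part of the form costs at most another \<gamma> sqrt
  n, hence d + 2 in place of d + 1. The first inequality turns a large eigenvalue into a large
  leading term, the second bounds that term by 4 \<mu> (1 - \<mu>) \<le> 1.\<close>

lemma eigenvalue_upper:
  fixes x :: "nat \<Rightarrow> real"
  assumes \<gamma>: "\<gamma> > 0" and err: "error_bound \<gamma> \<le> \<gamma> * sqrt n"
    and unit: "(\<Sum>i\<in>V. (x i)\<^sup>2) = 1"
    and ev: "\<And>i. i \<in> V \<Longrightarrow> (\<Sum>j\<in>V. adj E i j * x j) = \<rho> * x i"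
  shows "\<bar>\<rho>\<bar> \<le> 2 * \<bar>\<Sum>u\<in>good \<gamma>. x u * pull \<gamma> x u\<bar> + \<gamma> * (d + 2) * sqrt n"
    and "\<bar>\<rho>\<bar> \<le> sqrt (s * n) + \<gamma> * (d + 2) * sqrt n"
proof -
  define \<mu> where "\<mu> = (\<Sum>l\<in>heavy \<gamma>. (x l)\<^sup>2)"
  define B where "B = (\<Sum>u\<in>good \<gamma>. (pull \<gamma> x u)\<^sup>2)"
  define g where "g = (\<Sum>u\<in>good \<gamma>. x u * pull \<gamma> x u)"
  have "\<bar>\<rho>\<bar> \<le> 2 * \<bar>g\<bar> + \<gamma> * (d + 1) * sqrt n + error_bound \<gamma>"
  proof -
    have "(\<Sum>i\<in>V. \<Sum>j\<in>V. adj E i j * (x i * x j)) = \<rho>" using unit ev by (rule eigenvector_form)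
    then show ?thesis using form_bound[OF \<gamma> unit] by (simp only: g_def)
  qed
  then have 1: "\<bar>\<rho>\<bar> \<le> 2 * \<bar>g\<bar> + \<gamma> * (d + 2) * sqrt n"
    using err by (simp add: algebra_simps)
  then show "\<bar>\<rho>\<bar> \<le> 2 * \<bar>\<Sum>u\<in>good \<gamma>. x u * pull \<gamma> x u\<bar> + \<gamma> * (d + 2) * sqrt n"
    by (simp only: g_def)
  note pull_form = pull_form_le[OF unit, of \<gamma>, folded \<mu>_def B_def g_def]
  have "(2 * \<bar>g\<bar>)\<^sup>2 = 4 * g\<^sup>2" by (simp add: power_mult_distrib)
  also have "g\<^sup>2 \<le> (1 - \<mu>) * (s * n * \<mu>)"
    using pull_form(3) mult_left_mono[OF pull_form(2), of "1 - \<mu>"] pull_form(1) by linarith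
  also have "4 * ((1 - \<mu>) * (s * n * \<mu>)) = (4 * \<mu> * (1 - \<mu>)) * (s * n)" by simp
  also have "\<dots> \<le> 1 * real (s * n)"
  proof (rule mult_right_mono)
    have "0 \<le> (2 * \<mu> - 1)\<^sup>2" by simp
    then show "4 * \<mu> * (1 - \<mu>) \<le> 1" by (simp add: power2_eq_square algebra_simps)
  qed simp
  finally have "2 * \<bar>g\<bar> \<le> sqrt (s * n)" by (intro real_le_rsqrt) simp
  then show "\<bar>\<rho>\<bar> \<le> sqrt (s * n) + \<gamma> * (d + 2) * sqrt n" using 1 by linarith
qed

text \<open>Concentration speaks of heavy vertices only. At a light vertex u the eigenvalue equation
  and Cauchy-Schwarz give |\<rho> x u| \<le> sqrt (degree of u) \<le> \<gamma> sqrt n; as |\<rho>|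
  \<ge> sqrt n / 2, the entry is at most 2 \<gamma> in modulus.\<close>

lemma eigenvector_structure:
  fixes x :: "nat \<Rightarrow> real" and \<gamma> \<delta> \<eta> \<theta> \<rho> :: real
  assumes \<delta>: "0 < \<delta>" "\<delta> \<le> 1/4" and \<theta>: "\<theta> = \<delta>\<^sup>2 / (2 * s)" and \<eta>: "\<eta> = \<theta> / 8"
    and \<gamma>: "\<gamma> = \<eta> / (2 * d + 5)" and err: "error_bound \<gamma> \<le> \<gamma> * sqrt n"
    and unit: "(\<Sum>i\<in>V. (x i)\<^sup>2) = 1"
    and ev: "\<And>i. i \<in> V \<Longrightarrow> (\<Sum>j\<in>V. adj E i j * x j) = \<rho> * x i"
    and large: "sqrt (s * n) - \<gamma> * (d + 3) * sqrt n \<le> \<bar>\<rho>\<bar>"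
  obtains L m where "card L = s" "L \<subseteq> V" "m \<noteq> 0"
    "\<And>l. l \<in> L \<Longrightarrow> \<bar>x l - m\<bar> \<le> \<delta> * \<bar>m\<bar>" "\<And>l. l \<in> V - L \<Longrightarrow> \<bar>x l\<bar> \<le> \<delta> * \<bar>m\<bar>"
    "4 * card {u \<in> good \<gamma>. nb \<gamma> u = L} \<ge> 3 * n"
proof -
  have s: "real s \<ge> 1" using s_pos by simp
  have "\<theta> > 0" using \<delta> s by (simp add: \<theta>)
  then have "\<eta> > 0" by (simp add: \<eta>)
  then have \<gamma>0: "\<gamma> > 0" by (simp add: \<gamma>)
  \<comment> \<open>2 d + 5 is (d + 2) + (d + 3): the error of the upper estimate plus the shortfall
    allowed for |\<rho>|.\<close>
  have "\<gamma> * (2 * d + 5) = \<eta>" by (simp add: \<gamma>)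
  have "\<delta>\<^sup>2 \<le> 1/16" using power_mono[of \<delta> "1/4" 2] \<delta> by (simp add: power2_eq_square)
  moreover have \<eta>': "\<eta> = \<delta>\<^sup>2 / (16 * s)" by (simp add: \<eta> \<theta>)
  moreover have "\<delta>\<^sup>2 / (16 * s) \<le> \<delta>\<^sup>2 / 16" using s by (intro divide_left_mono) auto
  ultimately have "\<eta> \<le> 1/256" by simp
  have "\<eta> / (2 * d + 5) \<le> \<eta> / 1" using \<open>\<eta> > 0\<close> by (intro divide_left_mono) auto
  then have "\<gamma> \<le> \<eta>" by (simp add: \<gamma>)
  have sqn: "sqrt n > 0" using n_pos by simp
  have sqsn: "sqrt n \<le> sqrt (s * n)" using s n_pos by simp
  have "\<bar>\<rho>\<bar> \<le> 2 * \<bar>\<Sum>u\<in>good \<gamma>. x u * pull \<gamma> x u\<bar> + \<gamma> * (d + 2) * sqrt n"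
    using \<gamma>0 err unit ev by (rule eigenvalue_upper(1))
  then have "sqrt (s * n) - (\<gamma> * (2 * d + 5)) * sqrt n \<le> 2 * \<bar>\<Sum>u\<in>good \<gamma>. x u * pull \<gamma> x u\<bar>"
    using large by (simp add: algebra_simps)
  moreover have "\<eta> * sqrt n \<le> \<eta> * sqrt (s * n)" using sqsn \<open>\<eta> > 0\<close> by (intro mult_left_mono) auto
  ultimately have "(1 - \<eta>) * sqrt (s * n) \<le> 2 * \<bar>\<Sum>u\<in>good \<gamma>. x u * pull \<gamma> x u\<bar>"
    unfolding \<open>\<gamma> * (2 * d + 5) = \<eta>\<close> left_diff_distrib by linarith
  then obtain L m where L: "card L = s" "L \<subseteq> heavy \<gamma>" "m\<^sup>2 \<ge> 1 / (8 * s)"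
    "\<And>l. l \<in> L \<Longrightarrow> \<bar>x l - m\<bar> \<le> \<delta> * \<bar>m\<bar>" "\<And>l. l \<in> heavy \<gamma> - L \<Longrightarrow> \<bar>x l\<bar> \<le> \<delta> * \<bar>m\<bar>"
    "4 * card {u \<in> good \<gamma>. nb \<gamma> u = L} \<ge> 3 * n"
    by (rule concentration[OF unit \<delta> \<theta> \<eta>]) (rule that)
  have light: "\<bar>x u\<bar> \<le> \<delta> * \<bar>m\<bar>" if u: "u \<in> V - heavy \<gamma>" for u
  proof -
    have "(\<rho> * x u)\<^sup>2 \<le> (\<Sum>j\<in>V. (adj E u j)\<^sup>2) * (\<Sum>j\<in>V. (x j)\<^sup>2)"
      using u ev[of u] Cauchy_Schwarz_ineq_sum[of "adj E u" x V] by simp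
    also have "(\<Sum>j\<in>V. (adj E u j)\<^sup>2) = deg_in E V u"
      unfolding real_deg_in by (intro sum.cong refl) (simp add: adj_def)
    also have "real (deg_in E V u) * (\<Sum>j\<in>V. (x j)\<^sup>2) \<le> \<gamma>\<^sup>2 * n"
      using u unit by (auto simp: heavy_def)
    also have "\<dots> = (\<gamma> * sqrt n)\<^sup>2" by (simp add: power_mult_distrib)
    finally have "\<bar>\<rho> * x u\<bar> \<le> \<gamma> * sqrt n"
      using \<gamma>0 by (simp only: abs_le_square_iff[symmetric]) simp
    then have "\<bar>\<rho>\<bar> * \<bar>x u\<bar> \<le> \<gamma> * sqrt n" by (simp add: abs_mult)
    moreover have "\<gamma> * (d + 3) * sqrt n \<le> \<eta> * sqrt n"
      using \<gamma>0 sqn unfolding \<open>\<gamma> * (2 * d + 5) = \<eta>\<close>[symmetric] by (intro mult_right_mono mult_left_mono) auto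
    then have "sqrt n / 2 \<le> \<bar>\<rho>\<bar>"
      using large sqsn mult_right_mono[OF \<open>\<eta> \<le> 1/256\<close>, of "sqrt n"] sqn by linarith
    then have "sqrt n / 2 * \<bar>x u\<bar> \<le> \<bar>\<rho>\<bar> * \<bar>x u\<bar>" by (intro mult_right_mono) auto
    ultimately have "sqrt n * \<bar>x u\<bar> \<le> sqrt n * (2 * \<gamma>)" by (simp add: mult_ac)
    then have "\<bar>x u\<bar> \<le> 2 * \<gamma>" using sqn by (simp only: mult_le_cancel_left_pos)
    \<comment> \<open>Square and use 4 \<gamma> \<le> 2 and \<gamma> \<le> \<eta> = \<delta>^2 / (16
      s), against m^2 \<ge> 1 / (8 s).\<close>
    also have "2 * \<gamma> \<le> \<delta> * \<bar>m\<bar>"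
    proof (rule power2_le_imp_le)
      have "(2 * \<gamma>)\<^sup>2 = (4 * \<gamma>) * \<gamma>" by (simp add: power2_eq_square)
      also have "\<dots> \<le> 2 * (\<delta>\<^sup>2 / (16 * s))"
        using \<open>\<gamma> \<le> \<eta>\<close> \<open>\<eta> \<le> 1/256\<close> \<gamma>0 unfolding \<eta>'[symmetric] by (intro mult_mono) auto
      also have "\<dots> = \<delta>\<^sup>2 * (1 / (8 * s))" by simp
      also have "\<dots> \<le> \<delta>\<^sup>2 * m\<^sup>2" using L(3) by (intro mult_left_mono) auto
      also have "\<dots> = (\<delta> * \<bar>m\<bar>)\<^sup>2" by (simp add: power_mult_distrib)
      finally show "(2 * \<gamma>)\<^sup>2 \<le> (\<delta> * \<bar>m\<bar>)\<^sup>2" .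
    qed (use \<delta> in simp)
    finally show ?thesis .
  qed
  have "m \<noteq> 0" using L(3) s by auto
  have "\<bar>x l\<bar> \<le> \<delta> * \<bar>m\<bar>" if "l \<in> V - L" for l
    using L(5)[of l] light[of l] that by blast
  with L \<open>m \<noteq> 0\<close> heavy_subset[of \<gamma>] show ?thesis by (intro that[of L m]) auto
qed

text \<open>A vertex that counts for both eigenvectors forces the two heavy sets to coincide.\<close>

lemma common_structure:
  fixes x z :: "nat \<Rightarrow> real" and \<gamma> \<delta> \<eta> \<theta> \<rho> \<mu> :: real
  assumes \<delta>: "0 < \<delta>" "\<delta> \<le> 1/4" and \<theta>: "\<theta> = \<delta>\<^sup>2 / (2 * s)" and \<eta>: "\<eta> = \<theta> / 8"
    and \<gamma>: "\<gamma> = \<eta> / (2 * d + 5)" and err: "error_bound \<gamma> \<le> \<gamma> * sqrt n"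
    and x: "(\<Sum>i\<in>V. (x i)\<^sup>2) = 1" "\<And>i. i \<in> V \<Longrightarrow> (\<Sum>j\<in>V. adj E i j * x j) = \<rho> * x i"
    and z: "(\<Sum>i\<in>V. (z i)\<^sup>2) = 1" "\<And>i. i \<in> V \<Longrightarrow> (\<Sum>j\<in>V. adj E i j * z j) = \<mu> * z i"
    and gap: "2 * sqrt (s * n) - \<gamma> * sqrt n \<le> \<rho> - \<mu>"
  obtains L m k where "card L = s" "L \<subseteq> V" "m \<noteq> 0" "k \<noteq> 0" "\<rho> > 0" "\<mu> < 0"
    "\<And>l. l \<in> L \<Longrightarrow> \<bar>x l - m\<bar> \<le> \<delta> * \<bar>m\<bar>" "\<And>l. l \<in> V - L \<Longrightarrow> \<bar>x l\<bar> \<le> \<delta> * \<bar>m\<bar>"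
    "\<And>l. l \<in> L \<Longrightarrow> \<bar>z l - k\<bar> \<le> \<delta> * \<bar>k\<bar>" "\<And>l. l \<in> V - L \<Longrightarrow> \<bar>z l\<bar> \<le> \<delta> * \<bar>k\<bar>"
    "4 * card {u \<in> V - L. \<forall>l\<in>L. E u l} \<ge> 3 * n"
proof -
  have s: "real s \<ge> 1" using s_pos by simp
  have "\<theta> > 0" using \<delta> s by (simp add: \<theta>)
  then have "\<eta> > 0" by (simp add: \<eta>)
  then have \<gamma>0: "\<gamma> > 0" by (simp add: \<gamma>)
  have \<gamma>\<eta>: "\<gamma> * (2 * d + 5) = \<eta>" by (simp add: \<gamma>)
  have "\<delta>\<^sup>2 \<le> 1/16" using power_mono[of \<delta> "1/4" 2] \<delta> by (simp add: power2_eq_square)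
  moreover have "\<eta> = \<delta>\<^sup>2 / (16 * s)" by (simp add: \<eta> \<theta>)
  moreover have "\<delta>\<^sup>2 / (16 * s) \<le> \<delta>\<^sup>2 / 16" using s by (intro divide_left_mono) auto
  ultimately have "\<eta> \<le> 1/256" by simp
  have sqn: "sqrt n > 0" using n_pos by simp
  have sqsn: "sqrt n \<le> sqrt (s * n)" using s n_pos by simp
  have "\<bar>\<rho>\<bar> \<le> sqrt (s * n) + \<gamma> * (d + 2) * sqrt n"
    using \<gamma>0 err x by (rule eigenvalue_upper(2))
  moreover have "\<bar>\<mu>\<bar> \<le> sqrt (s * n) + \<gamma> * (d + 2) * sqrt n"
    using \<gamma>0 err z by (rule eigenvalue_upper(2))
  \<comment> \<open>Either modulus is at least the gap minus the upper bound for the other one; the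
    extra \<gamma> sqrt n in the gap raises d + 2 to d + 3.\<close>
  ultimately have low: "sqrt (s * n) - \<gamma> * (d + 3) * sqrt n \<le> \<rho>" "sqrt (s * n) - \<gamma> * (d + 3) * sqrt n \<le> - \<mu>"
    using gap by (simp_all add: algebra_simps)
  have "\<gamma> * (d + 3) * sqrt n \<le> \<eta> * sqrt n"
    using \<gamma>0 sqn unfolding \<gamma>\<eta>[symmetric] by (intro mult_right_mono mult_left_mono) auto
  then have "0 < sqrt (s * n) - \<gamma> * (d + 3) * sqrt n"
    using sqsn mult_right_mono[OF \<open>\<eta> \<le> 1/256\<close>, of "sqrt n"] sqn by linarith
  with low have sgn: "\<rho> > 0" "\<mu> < 0" by linarith+
  with low have low': "sqrt (s * n) - \<gamma> * (d + 3) * sqrt n \<le> \<bar>\<rho>\<bar>"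
    "sqrt (s * n) - \<gamma> * (d + 3) * sqrt n \<le> \<bar>\<mu>\<bar>" by linarith+
  obtain L m where L: "card L = s" "L \<subseteq> V" "m \<noteq> 0"
    "\<And>l. l \<in> L \<Longrightarrow> \<bar>x l - m\<bar> \<le> \<delta> * \<bar>m\<bar>" "\<And>l. l \<in> V - L \<Longrightarrow> \<bar>x l\<bar> \<le> \<delta> * \<bar>m\<bar>"
    "4 * card {u \<in> good \<gamma>. nb \<gamma> u = L} \<ge> 3 * n"
    using eigenvector_structure[OF \<delta> \<theta> \<eta> \<gamma> err x _ that] low'(1) by blast
  obtain K k where K: "card K = s" "K \<subseteq> V" "k \<noteq> 0"
    "\<And>l. l \<in> K \<Longrightarrow> \<bar>z l - k\<bar> \<le> \<delta> * \<bar>k\<bar>" "\<And>l. l \<in> V - K \<Longrightarrow> \<bar>z l\<bar> \<le> \<delta> * \<bar>k\<bar>"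
    "4 * card {u \<in> good \<gamma>. nb \<gamma> u = K} \<ge> 3 * n"
    using eigenvector_structure[OF \<delta> \<theta> \<eta> \<gamma> err z _ that] low'(2) by blast
  have fin: "finite (good \<gamma>)" using finV(1) by (simp add: good_def)
  have "K = L"
  proof (rule ccontr)
    assume "K \<noteq> L"
    then have "{u \<in> good \<gamma>. nb \<gamma> u = L} \<inter> {u \<in> good \<gamma>. nb \<gamma> u = K} = {}" by auto
    then have "card {u \<in> good \<gamma>. nb \<gamma> u = L} + card {u \<in> good \<gamma>. nb \<gamma> u = K} =
        card ({u \<in> good \<gamma>. nb \<gamma> u = L} \<union> {u \<in> good \<gamma>. nb \<gamma> u = K})"
      using fin by (simp add: card_Un_disjoint)
    also have "\<dots> \<le> n" using finV(1) by (intro card_mono) (auto simp: good_def)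
    finally show False using L(6) K(6) n_pos by linarith
  qed
  have "{u \<in> good \<gamma>. nb \<gamma> u = L} \<noteq> {}" using L(6) n_pos by (intro notI) simp
  then have "L \<subseteq> heavy \<gamma>" by (auto simp: nb_def)
  then have "{u \<in> good \<gamma>. nb \<gamma> u = L} \<subseteq> {u \<in> V - L. \<forall>l\<in>L. E u l}"
    by (auto simp: nb_def good_def)
  then have "card {u \<in> good \<gamma>. nb \<gamma> u = L} \<le> card {u \<in> V - L. \<forall>l\<in>L. E u l}"
    using finV(1) by (intro card_mono) auto
  then have "4 * card {u \<in> V - L. \<forall>l\<in>L. E u l} \<ge> 3 * n" using L(6) by linarith
  with that[OF L(1-3) K(3) sgn L(4,5) K(4,5)[unfolded \<open>K = L\<close>]] show ?thesis by blast
qed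

end

section \<open>Comparison with the join graph\<close>

text \<open>Edges inside \<open>L\<close> are kept, so E and the new graph differ only in pairs that
  meet V - L. For the empty relation the result is complete bipartite.\<close>

definition join_graph :: "'a set \<Rightarrow> 'a set \<Rightarrow> ('a \<Rightarrow> 'a \<Rightarrow> bool) \<Rightarrow> 'a \<Rightarrow> 'a \<Rightarrow> bool" where
  "join_graph V L E u v \<longleftrightarrow> u \<in> V \<and> v \<in> V \<and> u \<noteq> v \<and> (if u \<in> L \<and> v \<in> L then E u v else u \<in> L \<or> v \<in> L)"

context sparse_graph begin

text \<open>An eigenvector \<open>x\<close> for \<open>\<rho>\<close> becomes a test vector for the join graph by replacing its values
  off \<open>L\<close> by the value that the eigenvalue equation of the join graph would prescribe.\<close>

lemma join_test_vector:
  fixes x :: "nat \<Rightarrow> real" and \<rho> :: real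
  assumes LV: "L \<subseteq> V" and ev: "\<And>i. i \<in> V \<Longrightarrow> (\<Sum>j\<in>V. adj E i j * x j) = \<rho> * x i" and \<rho>: "\<rho> \<noteq> 0"
    and \<sigma>: "\<sigma> = (\<Sum>l\<in>L. x l)" and y: "\<And>i. y i = (if i \<in> L then x i else \<sigma> / \<rho>)"
    and \<beta>: "\<And>u. \<beta> u = (\<Sum>l\<in>L. adj E u l * x l)"
  shows "\<rho> * ((\<Sum>i\<in>V. \<Sum>j\<in>V. adj (join_graph V L E) i j * (y i * y j)) - \<rho> * (\<Sum>i\<in>V. (y i)\<^sup>2)) =
    (\<Sum>u\<in>V - L. \<sigma>\<^sup>2 - (\<beta> u)\<^sup>2) - (\<Sum>u\<in>V - L. \<beta> u * (\<Sum>v\<in>V - L. adj E u v * x v))"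
proof -
  define U where "U = V - L"
  define N where "N = real (card U)"
  let ?J = "join_graph V L E"
  have fin: "finite L" "finite U" using LV finV(1) finite_subset by (auto simp: U_def)
  have split: "sum f V = sum f L + sum f U" for f :: "nat \<Rightarrow> real"
    unfolding U_def using LV finV(1) by (simp add: sum.subset_diff add.commute)
  define Q X where "Q = (\<Sum>i\<in>L. \<Sum>j\<in>L. adj E i j * (x i * x j))" and "X = (\<Sum>i\<in>L. (x i)\<^sup>2)"
  define \<tau> where "\<tau> = (\<Sum>u\<in>U. x u * \<beta> u)"
  define c where "c u = (\<Sum>v\<in>U. adj E u v * x v)" for u
  have "(\<Sum>i\<in>L. \<Sum>j\<in>L. adj ?J i j * (y i * y j)) = Q"
    unfolding Q_def
  proof (intro sum.cong refl)
    fix i j assume "i \<in> L" "j \<in> L"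
    moreover have "\<not> E j j" using E[of j j] by blast
    ultimately show "adj ?J i j * (y i * y j) = adj E i j * (x i * x j)"
      using LV by (auto simp: adj_def join_graph_def y)
  qed
  moreover have "(\<Sum>i\<in>L. \<Sum>j\<in>U. adj ?J i j * (y i * y j)) = N * (\<sigma> * (\<sigma> / \<rho>))"
  proof -
    have "(\<Sum>i\<in>L. \<Sum>j\<in>U. adj ?J i j * (y i * y j)) = (\<Sum>i\<in>L. \<Sum>j\<in>U. x i * (\<sigma> / \<rho>))"
      using LV by (intro sum.cong refl) (auto simp: adj_def join_graph_def y U_def)
    also have "\<dots> = N * (\<sigma> * (\<sigma> / \<rho>))"
      by (simp only: sum_constant N_def \<sigma> sum_distrib_right sum_distrib_left)
    finally show ?thesis .
  qed
  moreover have "(\<Sum>i\<in>U. \<Sum>j\<in>L. adj ?J i j * (y i * y j)) = N * (\<sigma> * (\<sigma> / \<rho>))"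
  proof -
    have "(\<Sum>i\<in>U. \<Sum>j\<in>L. adj ?J i j * (y i * y j)) = (\<Sum>i\<in>U. \<Sum>j\<in>L. x j * (\<sigma> / \<rho>))"
      using LV by (intro sum.cong refl) (auto simp: adj_def join_graph_def y U_def)
    also have "\<dots> = N * (\<sigma> * (\<sigma> / \<rho>))"
      by (simp only: sum_constant N_def \<sigma> sum_distrib_right sum_distrib_left)
    finally show ?thesis .
  qed
  moreover have "(\<Sum>i\<in>U. \<Sum>j\<in>U. adj ?J i j * (y i * y j)) = 0"
    by (intro sum.neutral ballI) (auto simp: adj_def join_graph_def U_def)
  ultimately have form: "(\<Sum>i\<in>V. \<Sum>j\<in>V. adj ?J i j * (y i * y j)) = Q + 2 * (N * (\<sigma> * (\<sigma> / \<rho>)))"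
    unfolding split sum.distrib by simp
  have "(\<Sum>i\<in>L. (y i)\<^sup>2) = X" unfolding X_def by (intro sum.cong refl) (simp add: y)
  moreover have "(\<Sum>i\<in>U. (y i)\<^sup>2) = (\<Sum>i\<in>U. (\<sigma> / \<rho>)\<^sup>2)"
    by (intro sum.cong refl) (simp add: y U_def)
  ultimately have norm: "(\<Sum>i\<in>V. (y i)\<^sup>2) = X + N * (\<sigma> / \<rho>)\<^sup>2"
    unfolding split by (simp add: N_def)
  \<comment> \<open>The eigenvalue equations on \<open>L\<close>, weighted by x, tie Q to X and
    \<tau>.\<close>
  have "\<rho> * X = (\<Sum>i\<in>L. x i * (\<Sum>j\<in>V. adj E i j * x j))"
    unfolding X_def sum_distrib_left[of \<rho>]
    using LV by (intro sum.cong refl) (auto simp: ev power2_eq_square)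
  also have "\<dots> = Q + (\<Sum>i\<in>L. \<Sum>u\<in>U. adj E i u * (x i * x u))"
    unfolding split Q_def by (simp add: distrib_left sum.distrib sum_distrib_left mult.left_commute)
  also have "(\<Sum>i\<in>L. \<Sum>u\<in>U. adj E i u * (x i * x u)) = \<tau>"
    unfolding \<tau>_def \<beta> sum_distrib_left
    by (subst sum.swap) (intro sum.cong refl, simp add: adj_sym mult_ac)
  finally have 1: "\<rho> * X = Q + \<tau>" .
  \<comment> \<open>The equations off \<open>L\<close>, weighted by \<beta>, turn \<tau> into the
    terms of the claim.\<close>
  have "\<rho> * \<tau> = (\<Sum>u\<in>U. (\<beta> u)\<^sup>2 + \<beta> u * c u)"
    unfolding \<tau>_def sum_distrib_left
  proof (intro sum.cong refl)
    fix u assume "u \<in> U"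
    then have "\<rho> * x u = \<beta> u + c u" using ev[of u] unfolding split \<beta> c_def by (simp add: U_def)
    then have "\<rho> * (x u * \<beta> u) = (\<beta> u + c u) * \<beta> u" by simp
    then show "\<rho> * (x u * \<beta> u) = (\<beta> u)\<^sup>2 + \<beta> u * c u" by (simp add: power2_eq_square algebra_simps)
  qed
  then have 2: "\<rho> * \<tau> = (\<Sum>u\<in>U. (\<beta> u)\<^sup>2) + (\<Sum>u\<in>U. \<beta> u * c u)" by (simp add: sum.distrib)
  \<comment> \<open>The factor \<rho> clears denominators without a decision on its sign, so the
    identity applies at both ends of the spectrum.\<close>
  have "\<rho> * ((Q + 2 * (N * (\<sigma> * (\<sigma> / \<rho>)))) - \<rho> * (X + N * (\<sigma> / \<rho>)\<^sup>2))
      = \<rho> * (Q - \<rho> * X) + N * \<sigma>\<^sup>2"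
    using \<rho> by (simp add: field_simps power2_eq_square)
  also have "\<dots> = N * \<sigma>\<^sup>2 - \<rho> * \<tau>" unfolding 1 by (simp add: algebra_simps)
  also have "\<dots> = (\<Sum>u\<in>U. \<sigma>\<^sup>2 - (\<beta> u)\<^sup>2) - (\<Sum>u\<in>U. \<beta> u * c u)"
    unfolding 2 by (simp add: sum_subtractf N_def)
  finally show ?thesis unfolding form norm c_def U_def .
qed

text \<open>Each vertex of \<open>T\<close> misses a vertex of L and gains at least s (1 -
  \<delta>)^2 m^2, while an ordered edge off L costs at most s (1 + \<delta>) \<delta> m^2. There
  are at most (d + 2) |T| such edges and \<delta> (d + 2) = 1/4, so the comparison is 9/32 <
  49/64.\<close>

lemma join_gain_pos:
  fixes x :: "nat \<Rightarrow> real"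
  assumes L: "L \<subseteq> V" "card L = s" and T: "T = {u \<in> V - L. \<exists>l\<in>L. \<not> E u l}" "T \<noteq> {}"
    and vol: "vol E (V - L) \<le> (d + 2) * card T"
    and \<delta>: "\<delta> = 1 / (4 * (d + 2))" and m: "m \<noteq> 0"
    and xL: "\<And>l. l \<in> L \<Longrightarrow> \<bar>x l - m\<bar> \<le> \<delta> * \<bar>m\<bar>" and xU: "\<And>u. u \<in> V - L \<Longrightarrow> \<bar>x u\<bar> \<le> \<delta> * \<bar>m\<bar>"
    and \<sigma>: "\<sigma> = (\<Sum>l\<in>L. x l)" and \<beta>: "\<And>u. \<beta> u = (\<Sum>l\<in>L. adj E u l * x l)"
  shows "0 < (\<Sum>u\<in>V - L. \<sigma>\<^sup>2 - (\<beta> u)\<^sup>2) - (\<Sum>u\<in>V - L. \<beta> u * (\<Sum>v\<in>V - L. adj E u v * x v))"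
proof -
  define U where "U = V - L"
  have fin: "finite L" "finite U" "finite T" using L(1) finV(1) finite_subset by (auto simp: U_def T)
  have s: "real s \<ge> 1" using s_pos by simp
  have \<delta>1: "0 < \<delta>" "\<delta> \<le> 1/8" "\<delta> * (d + 2) = 1/4"
  proof -
    show "0 < \<delta>" by (simp add: \<delta>)
    show "\<delta> * (d + 2) = 1/4" by (simp add: \<delta> field_simps)
    have "1 / (4 * (real d + 2)) \<le> 1 / 8" by (intro divide_left_mono) auto
    then show "\<delta> \<le> 1/8" by (simp add: \<delta>)
  qed
  \<comment> \<open>As m may be negative, entries on \<open>L\<close> are multiplied by m, which
    makes them nonnegative.\<close>
  have xm: "(1 - \<delta>) * m\<^sup>2 \<le> m * x l" if "l \<in> L" for l
  proof -
    have "\<bar>m * (x l - m)\<bar> \<le> \<bar>m\<bar> * (\<delta> * \<bar>m\<bar>)"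
      unfolding abs_mult using xL[OF that] by (intro mult_left_mono) auto
    also have "\<dots> = \<delta> * m\<^sup>2" by (simp add: power2_eq_square)
    finally show ?thesis by (simp add: algebra_simps power2_eq_square abs_le_iff)
  qed
  have pos: "0 < (1 - \<delta>) * m\<^sup>2" using \<delta>1 m by simp
  have xm0: "0 \<le> m * x l" if "l \<in> L" for l using xm[OF that] pos by linarith
  have xabs: "\<bar>x l\<bar> \<le> (1 + \<delta>) * \<bar>m\<bar>" if "l \<in> L" for l
    using xL[OF that] unfolding distrib_right by linarith
  have gain: "s * (1 - \<delta>)\<^sup>2 * m\<^sup>2 \<le> \<sigma>\<^sup>2 - (\<beta> u)\<^sup>2" if u: "u \<in> T" for u
  proof -
    obtain l0 where l0: "l0 \<in> L" "\<not> E u l0" using u by (auto simp: T)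
    have "m * \<beta> u = (\<Sum>l\<in>L. adj E u l * (m * x l))"
      unfolding \<beta> by (simp add: sum_distrib_left mult.left_commute)
    also have "\<dots> \<ge> 0" by (intro sum_nonneg mult_nonneg_nonneg[OF adj_nonneg] xm0)
    finally have m\<beta>: "m * \<beta> u \<ge> 0" .
    have "real s * ((1 - \<delta>) * m\<^sup>2) = (\<Sum>l\<in>L. (1 - \<delta>) * m\<^sup>2)" using L(2) by simp
    also have "\<dots> \<le> (\<Sum>l\<in>L. m * x l)" using xm by (rule sum_mono)
    also have "\<dots> = m * \<sigma>" by (simp add: \<sigma> sum_distrib_left)
    finally have m\<sigma>: "s * ((1 - \<delta>) * m\<^sup>2) \<le> m * \<sigma>" .
    have "m * \<sigma> - m * \<beta> u = (\<Sum>l\<in>L. (1 - adj E u l) * (m * x l))"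
      unfolding \<sigma> \<beta> by (simp add: sum_distrib_left sum_subtractf algebra_simps)
    also have "\<dots> \<ge> (1 - adj E u l0) * (m * x l0)"
    proof (rule member_le_sum[OF l0(1) _ fin(1)])
      fix l assume "l \<in> L - {l0}"
      then show "0 \<le> (1 - adj E u l) * (m * x l)"
        using xm0[of l] adj_le_1[of E u l] by (intro mult_nonneg_nonneg[of "1 - adj E u l"]) auto
    qed
    finally have "(1 - \<delta>) * m\<^sup>2 \<le> m * \<sigma> - m * \<beta> u" using xm[OF l0(1)] l0(2) by (simp add: adj_def)
    \<comment> \<open>\<sigma>^2 - \<beta>^2 is factored into difference and sum, each carrying a
      factor m.\<close>
    then have "((1 - \<delta>) * m\<^sup>2) * (s * ((1 - \<delta>) * m\<^sup>2)) \<le> (m * \<sigma> - m * \<beta> u) * (m * \<sigma> + m * \<beta> u)"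
      using pos m\<beta> m\<sigma> s by (intro mult_mono) auto
    then have "m\<^sup>2 * (s * (1 - \<delta>)\<^sup>2 * m\<^sup>2) \<le> m\<^sup>2 * (\<sigma>\<^sup>2 - (\<beta> u)\<^sup>2)"
      by (simp add: power2_eq_square algebra_simps)
    moreover have "0 < m\<^sup>2" using m by simp
    ultimately show ?thesis by (simp only: mult_le_cancel_left_pos)
  qed
  have full: "\<beta> u = \<sigma>" if "u \<in> U - T" for u
    using that unfolding \<beta> \<sigma> by (intro sum.cong) (auto simp: U_def T adj_def)
  have TU: "T \<subseteq> U" by (auto simp: T U_def)
  define t where "t = real (card T)"
  have t: "t > 0" using T(2) fin by (simp add: t_def card_gt_0_iff)
  have "t * (s * (1 - \<delta>)\<^sup>2 * m\<^sup>2) = (\<Sum>u\<in>T. s * (1 - \<delta>)\<^sup>2 * m\<^sup>2)" by (simp add: t_def)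
  also have "\<dots> \<le> (\<Sum>u\<in>T. \<sigma>\<^sup>2 - (\<beta> u)\<^sup>2)" using gain by (rule sum_mono)
  also have "\<dots> = (\<Sum>u\<in>U. \<sigma>\<^sup>2 - (\<beta> u)\<^sup>2)"
    using fin TU full by (intro sum.mono_neutral_left) auto
  finally have A: "t * (s * (1 - \<delta>)\<^sup>2 * m\<^sup>2) \<le> (\<Sum>u\<in>U. \<sigma>\<^sup>2 - (\<beta> u)\<^sup>2)" .
  have "(\<Sum>u\<in>U. \<beta> u * (\<Sum>v\<in>U. adj E u v * x v)) \<le>
     (\<Sum>u\<in>U. (s * ((1 + \<delta>) * \<bar>m\<bar>)) * (deg_in E U u * (\<delta> * \<bar>m\<bar>)))"
  proof (rule sum_mono)
    fix u assume "u \<in> U"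
    have "\<bar>\<beta> u\<bar> \<le> (\<Sum>l\<in>L. (1 + \<delta>) * \<bar>m\<bar>)"
      unfolding \<beta>
    proof (intro sum_abs[THEN order_trans] sum_mono)
      fix l assume "l \<in> L"
      have "\<bar>adj E u l * x l\<bar> \<le> 1 * \<bar>x l\<bar>"
        unfolding abs_mult using adj_le_1[of E u l] by (intro mult_right_mono) auto
      then show "\<bar>adj E u l * x l\<bar> \<le> (1 + \<delta>) * \<bar>m\<bar>" using xabs[OF \<open>l \<in> L\<close>] by linarith
    qed
    then have 1: "\<bar>\<beta> u\<bar> \<le> s * ((1 + \<delta>) * \<bar>m\<bar>)" using L(2) by simp
    have "\<bar>\<Sum>v\<in>U. adj E u v * x v\<bar> \<le> (\<Sum>v\<in>U. adj E u v * (\<delta> * \<bar>m\<bar>))"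
    proof (intro sum_abs[THEN order_trans] sum_mono)
      fix v assume "v \<in> U"
      then have "\<bar>x v\<bar> \<le> \<delta> * \<bar>m\<bar>" using xU by (simp add: U_def)
      then show "\<bar>adj E u v * x v\<bar> \<le> adj E u v * (\<delta> * \<bar>m\<bar>)"
        by (simp add: abs_mult mult_left_mono)
    qed
    also have "\<dots> = deg_in E U u * (\<delta> * \<bar>m\<bar>)" by (simp only: real_deg_in sum_distrib_right)
    finally have 2: "\<bar>\<Sum>v\<in>U. adj E u v * x v\<bar> \<le> deg_in E U u * (\<delta> * \<bar>m\<bar>)" .
    have "\<bar>\<beta> u * (\<Sum>v\<in>U. adj E u v * x v)\<bar> \<le> (s * ((1 + \<delta>) * \<bar>m\<bar>)) * (deg_in E U u * (\<delta> * \<bar>m\<bar>))"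
      unfolding abs_mult[of "\<beta> u"] using 1 2 \<delta>1 by (intro mult_mono) auto
    then show "\<beta> u * (\<Sum>v\<in>U. adj E u v * x v) \<le> (s * ((1 + \<delta>) * \<bar>m\<bar>)) * (deg_in E U u * (\<delta> * \<bar>m\<bar>))"
      by linarith
  qed
  also have "\<dots> = (s * (1 + \<delta>) * \<delta> * m\<^sup>2) * real (vol E U)"
  proof -
    have "(s * ((1 + \<delta>) * \<bar>m\<bar>)) * (deg_in E U u * (\<delta> * \<bar>m\<bar>)) = (s * (1 + \<delta>) * \<delta> * m\<^sup>2) * real (deg_in E U u)" for u
      by (simp add: power2_eq_square)
    then show ?thesis by (simp only: vol_def of_nat_sum sum_distrib_left)
  qed
  also have "\<dots> \<le> (s * (1 + \<delta>) * \<delta> * m\<^sup>2) * ((d + 2) * t)"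
  proof (rule mult_left_mono)
    show "real (vol E U) \<le> (d + 2) * t"
      using vol unfolding U_def t_def by (simp only: of_nat_le_iff flip: of_nat_mult)
  qed (use \<delta>1 in simp)
  also have "\<dots> = t * (s * ((1 + \<delta>) * (\<delta> * (d + 2))) * m\<^sup>2)" by (simp only: mult_ac)
  also have "\<dots> < t * (s * (1 - \<delta>)\<^sup>2 * m\<^sup>2)"
  proof -
    have "(1 + \<delta>) * (\<delta> * (d + 2)) \<le> 9/8 * (1/4)" unfolding \<delta>1(3) using \<delta>1(2) by simp
    also have "\<dots> < (7/8)\<^sup>2" by (simp add: power2_eq_square)
    also have "\<dots> \<le> (1 - \<delta>)\<^sup>2" using \<delta>1 by (intro power_mono) auto
    finally have "(1 + \<delta>) * (\<delta> * (d + 2)) < (1 - \<delta>)\<^sup>2" .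
    then show ?thesis using t s m
      by (intro mult_strict_left_mono mult_strict_right_mono) auto
  qed
  finally show ?thesis using A unfolding U_def by linarith
qed

end

section \<open>Extremal minor-free graphs\<close>

text \<open>If r - 1 vertices had at least r common neighbours, one of these would be a branch set
  by itself and the others would supply partners for the r - 1 vertices, giving a K_r minor.\<close>

lemma sparse_graph_K_minor_free:
  assumes G: "simple_graph n E" and free: "K_minor_free r n E" and "r \<ge> 3" "n > 0"
  shows "sparse_graph E {0..<n} (2 ^ r) (r - 2)"
proof
  have E: "E b a \<and> a \<noteq> b" if "E a b" for a b
    using G that unfolding simple_graph_def by blast
  have noK: "\<not> K_minor_in r E S" if "S \<subseteq> {0..<n}" for S
    using free K_minor_in_mono[OF _ that, of r E] by (auto simp: K_minor_free_def has_K_minor_eq)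
  show "E b a \<and> a \<noteq> b" if "E a b" for a b using that by (rule E)
  show "finite {0..<n}" "{0..<n} \<noteq> {}" "1 \<le> r - 2" "1 \<le> (2::nat) ^ r" using assms(3,4) by auto
  show "vol E T \<le> 2 ^ r * card T" if T: "T \<subseteq> {0..<n}" for T
  proof (cases "T = {}")
    case True
    then show ?thesis by (simp add: vol_def)
  next
    case False
    have "finite T" using T finite_subset by blast
    show ?thesis
    proof (rule ccontr)
      assume "\<not> vol E T \<le> 2 ^ r * card T"
      then have "2 ^ r * card T \<le> vol E T" by simp
      then have "K_minor_in r E T" using dense_imp_K_minor[of E T r, OF E \<open>finite T\<close> False] by blast
      then show False using noK[OF T] by blast
    qed
  qed
  show "card {u \<in> {0..<n} - Q. \<forall>l\<in>Q. E u l} \<le> Suc (r - 2)"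
    if Q: "Q \<subseteq> {0..<n}" "card Q = Suc (r - 2)" for Q
  proof (rule ccontr)
    let ?C = "{u \<in> {0..<n} - Q. \<forall>l\<in>Q. E u l}"
    assume "\<not> card ?C \<le> Suc (r - 2)"
    then have C: "card ?C > card Q" using Q(2) by simp
    then have "?C \<noteq> {}" by (metis card.empty not_less_zero)
    then obtain w where w: "w \<in> ?C" by blast
    have "K_minor_in (card Q + 1) E {0..<n}"
    proof (rule K_minor_common_neighbours[of E Q "?C - {w}" _ 1 "\<lambda>_. {w}"])
      show "finite Q" using Q(1) finite_subset by blast
      show "card Q \<le> card (?C - {w})" using C w by simp
      show "E b a \<and> a \<noteq> b" if "E a b" for a b using that by (rule E)
    qed (use w Q(1) in auto)
    moreover have "card Q + 1 = r" using Q(2) \<open>r \<ge> 3\<close> by simp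
    ultimately show False using noK[of "{0..<n}"] by simp
  qed
qed

text \<open>Two adjacent connected sets off \<open>L\<close> that both contain a vertex joined to all of \<open>L\<close> would
  complete a \<open>K\<^sub>r\<close> minor.\<close>

lemma common_neighbours_off_edges:
  assumes E: "\<And>a b. E a b \<Longrightarrow> E b a \<and> a \<noteq> b"
    and V: "finite V" and L: "L \<subseteq> V" and free: "\<not> K_minor_in (card L + 2) E V"
    and W: "W = {u \<in> V - L. \<forall>l\<in>L. E u l}" and big: "card L + 3 \<le> card W"
  shows "w \<in> W \<Longrightarrow> w' \<in> W \<Longrightarrow> \<not> E w w'"
    and "t \<in> V - L - W \<Longrightarrow> card {w \<in> W. E t w} \<le> 1"
proof -
  have finW: "finite W" using V by (simp add: W)
  have finL: "finite L" using L V finite_subset by blast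
  \<comment> \<open>p and q witness adjacency of the two sets, p' and q' their adjacency to all of
    \<open>L\<close>. The sets use at most 3 vertices, so card L + 3 members of \<open>W\<close>
    leave enough private partners.\<close>
  have *: False if PQ: "P \<subseteq> V - L" "Q \<subseteq> V - L" "card (P \<union> Q) \<le> 3" "finite (P \<union> Q)" "P \<inter> Q = {}"
    "connected_in E P" "connected_in E Q"
    "p \<in> P" "q \<in> Q" "E p q" "p' \<in> P" "q' \<in> Q" "p' \<in> W" "q' \<in> W" for P Q p q p' q'
  proof -
    have "K_minor_in (card L + 2) E V"
    proof (rule K_minor_common_neighbours[of E L "W - (P \<union> Q)" _ 2 "\<lambda>i. if i = 0 then P else Q"])
      show "E b a \<and> a \<noteq> b" if "E a b" for a b using that by (rule E)
      show "card L \<le> card (W - (P \<union> Q))"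
        using diff_card_le_card_Diff[OF PQ(4), of W] PQ(3) big by linarith
      show "(if i = 0 then P else Q) \<inter> (if j = 0 then P else Q) = {} \<and>
        (\<exists>u\<in>if i = 0 then P else Q. \<exists>v\<in>if j = 0 then P else Q. E u v)"
        if "i < 2" "j < 2" "i \<noteq> j" for i j :: nat
      proof (cases "i = 0")
        case True
        then have "j \<noteq> 0" using that by simp
        then show ?thesis using True PQ(5,8,9,10) by auto
      next
        case False
        then have "j = 0" using that by simp
        then show ?thesis using False PQ(5,8,9) E[OF PQ(10)] by auto
      qed
      show "(if i = 0 then P else Q) \<subseteq> V - L - (W - (P \<union> Q)) \<and> connected_in E (if i = 0 then P else Q) \<and>
        (\<exists>w\<in>if i = 0 then P else Q. \<forall>l\<in>L. E w l)" if "i < 2" for i :: nat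
      proof (cases "i = 0")
        case True
        have "\<forall>l\<in>L. E p' l" using PQ(13) by (simp add: W)
        then show ?thesis using True PQ(1,6,11) by auto
      next
        case False
        have "\<forall>l\<in>L. E q' l" using PQ(14) by (simp add: W)
        then show ?thesis using False PQ(2,7,12) by auto
      qed
    qed (use finL finW L in \<open>auto simp: W\<close>)
    then show False using free by blast
  qed
  show "\<not> E w w'" if "w \<in> W" "w' \<in> W"
  proof
    assume "E w w'"
    then have "w \<noteq> w'" using E by blast
    then show False
      using *[of "{w}" "{w'}" w w' w w'] that \<open>E w w'\<close> by (auto simp: W)
  qed
  show "card {w \<in> W. E t w} \<le> 1" if t: "t \<in> V - L - W"
  proof (rule ccontr)
    assume "\<not> card {w \<in> W. E t w} \<le> 1"
    then have "2 \<le> card {w \<in> W. E t w}" by simp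
    then obtain A where A: "A \<subseteq> {w \<in> W. E t w}" "card A = 2" by (meson obtain_subset_with_card_n)
    then obtain a b where "A = {a, b}" "a \<noteq> b" unfolding card_2_iff by blast
    then have ab: "a \<in> W" "b \<in> W" "E t a" "E t b" "a \<noteq> b" using A(1) by auto
    have "E a t" "E b t" using ab E by blast+
    moreover have "t \<notin> W" "t \<in> V - L" using t by auto
    moreover have "t \<noteq> a" "t \<noteq> b" using t ab by auto
    \<comment> \<open>t misses some vertex of \<open>L\<close>, so b is adjoined to make {t, b}
      adjacent to all of \<open>L\<close>; the edge from a to t links it to {a}.\<close>
    ultimately show False
      using *[of "{a}" "{t, b}" a t a b] ab connected_in_pair[of E t b] by (auto simp: W card_insert_if)
  qed
qed

text \<open>\<open>W\<close> spans no edge, T = U - W spans at most d |T| ordered ones, and each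
  vertex of T has at most one edge to \<open>W\<close>, counted in both orders: this is the origin
  of d + 2.\<close>

lemma vol_off_common_neighbours:
  assumes E: "\<And>a b. E a b \<Longrightarrow> E b a \<and> a \<noteq> b"
    and U: "finite U" and W: "W \<subseteq> U" and sparse: "vol E (U - W) \<le> d * card (U - W)"
    and indep: "\<And>u w. u \<in> W \<Longrightarrow> w \<in> W \<Longrightarrow> \<not> E u w"
    and one: "\<And>t. t \<in> U - W \<Longrightarrow> card {w \<in> W. E t w} \<le> 1"
  shows "vol E U \<le> (d + 2) * card (U - W)"
proof -
  define T where "T = U - W"
  have fin: "finite W" "finite T" using U W finite_subset by (auto simp: T_def)
  have split: "sum f U = sum f W + sum f T" for f :: "_ \<Rightarrow> nat"
    unfolding T_def using W U by (simp add: sum.subset_diff add.commute)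
  have deg: "deg_in E U v = deg_in E W v + deg_in E T v" for v
    unfolding deg_in_def by (rule split)
  have "(\<Sum>v\<in>W. deg_in E T v) = (\<Sum>v\<in>T. deg_in E W v)"
  proof -
    have "E a b = E b a" for a b using E[of a b] E[of b a] by blast
    then show ?thesis unfolding deg_in_def by (subst sum.swap) (intro sum.cong refl, simp)
  qed
  moreover have "deg_in E W v = 0" if "v \<in> W" for v
    using indep[OF that] unfolding deg_in_def by (intro sum.neutral) simp
  then have "(\<Sum>v\<in>W. deg_in E W v) = 0" by simp
  moreover have "(\<Sum>v\<in>T. deg_in E W v) \<le> (\<Sum>v\<in>T. 1)"
    using one by (intro sum_mono) (simp add: deg_in_card[OF fin(1)] T_def)
  ultimately have "vol E U \<le> vol E T + 2 * card T"
    unfolding vol_def split deg sum.distrib by simp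
  then show ?thesis using sparse by (simp add: T_def)
qed

section \<open>Competitor graphs and their spread\<close>

lemma simple_join_graph:
  assumes "simple_graph n E" "L \<subseteq> {0..<n}"
  shows "simple_graph n (join_graph {0..<n} L E)"
  using assms by (auto simp: simple_graph_def join_graph_def split: if_splits)

lemma K_minor_free_join_graph:
  assumes "L \<subseteq> {0..<n}" "card L + 2 \<le> r"
  shows "K_minor_free r n (join_graph {0..<n} L E)"
  unfolding K_minor_free_def has_K_minor_eq
proof (rule K_minor_free_cover[of L])
  show "finite L" using assms(1) finite_subset by blast
  show "u \<in> L \<or> v \<in> L" if "join_graph {0..<n} L E u v" for u v
    using that by (auto simp: join_graph_def split: if_splits)
qed (rule assms(2))

text \<open>The vectors with sqrt q on the first s vertices and plus or minus sqrt p on the others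
  are eigenvectors of K_{s,n-s} for plus or minus sqrt (p q); they are inserted into the Rayleigh
  bounds.\<close>

lemma spread_complete_bipartite:
  assumes s: "0 < s" "s < n"
  shows "2 * sqrt (real s * (real n - real s)) \<le> spread n (join_graph {0..<n} {0..<s} (\<lambda>_ _. False))"
proof -
  let ?H = "join_graph {0..<n} {0..<s} (\<lambda>_ _. False)" and ?V = "{0..<n}"
  have "simple_graph n (\<lambda>_ _. False)" by (simp add: simple_graph_def)
  then have H: "simple_graph n ?H" using s by (intro simple_join_graph) auto
  obtain \<rho> \<mu> where sp: "spread n ?H = \<rho> - \<mu>"
    and up: "\<And>y. (\<Sum>i\<in>?V. \<Sum>j\<in>?V. adj ?H i j * (y i * y j)) \<le> \<rho> * (\<Sum>i\<in>?V. (y i)\<^sup>2)"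
    and low: "\<And>y. (\<Sum>i\<in>?V. \<Sum>j\<in>?V. adj ?H i j * (y i * y j)) \<ge> \<mu> * (\<Sum>i\<in>?V. (y i)\<^sup>2)"
    by (rule spread_eigenpairs[OF H]) (use s in auto)
  define p q where "p = real s" and "q = real n - real s"
  have pq: "p > 0" "q > 0" using s by (auto simp: p_def q_def)
  have cards: "real (card {0..<s}) = p" "real (card {s..<n}) = q"
    using s by (auto simp: p_def q_def of_nat_diff)
  define y where "y c i = (if i < s then sqrt q else c * sqrt p)" for c :: real and i
  have split: "sum f ?V = sum f {0..<s} + sum f {s..<n}" for f :: "nat \<Rightarrow> real"
    using s by (intro sum.atLeastLessThan_concat[symmetric]) auto
  have norm: "(\<Sum>i\<in>?V. (y c i)\<^sup>2) = 2 * (p * q)" if "c\<^sup>2 = 1" for c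
  proof -
    have "(\<Sum>i\<in>{0..<s}. (y c i)\<^sup>2) = (\<Sum>i\<in>{0..<s}. q)"
      using pq by (intro sum.cong refl) (simp add: y_def)
    moreover have "(\<Sum>i\<in>{s..<n}. (y c i)\<^sup>2) = (\<Sum>i\<in>{s..<n}. p)"
      using pq that by (intro sum.cong refl) (simp add: y_def power_mult_distrib)
    ultimately show ?thesis unfolding split by (simp only: sum_constant cards) simp
  qed
  have form: "(\<Sum>i\<in>?V. \<Sum>j\<in>?V. adj ?H i j * (y c i * y c j)) = c * (2 * (p * q) * sqrt (p * q))" for c
  proof -
    have "(\<Sum>i\<in>{0..<s}. \<Sum>j\<in>{0..<s}. adj ?H i j * (y c i * y c j)) = 0"
      by (intro sum.neutral ballI) (simp add: adj_def join_graph_def)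
    moreover have "(\<Sum>i\<in>{s..<n}. \<Sum>j\<in>{s..<n}. adj ?H i j * (y c i * y c j)) = 0"
      by (intro sum.neutral ballI) (simp add: adj_def join_graph_def)
    moreover have "(\<Sum>i\<in>{0..<s}. \<Sum>j\<in>{s..<n}. adj ?H i j * (y c i * y c j)) =
        (\<Sum>i\<in>{0..<s}. \<Sum>j\<in>{s..<n}. c * sqrt (p * q))"
      using s by (intro sum.cong refl) (auto simp: adj_def join_graph_def y_def real_sqrt_mult)
    moreover have "(\<Sum>i\<in>{s..<n}. \<Sum>j\<in>{0..<s}. adj ?H i j * (y c i * y c j)) =
        (\<Sum>i\<in>{s..<n}. \<Sum>j\<in>{0..<s}. c * sqrt (p * q))"
      using s by (intro sum.cong refl) (auto simp: adj_def join_graph_def y_def real_sqrt_mult)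
    ultimately show ?thesis unfolding split sum.distrib by (simp only: sum_constant cards) simp
  qed
  have "(2 * (p * q)) * sqrt (p * q) \<le> (2 * (p * q)) * \<rho>"
  proof -
    have "(\<Sum>i\<in>?V. (y 1 i)\<^sup>2) = 2 * (p * q)" by (rule norm) simp
    then show ?thesis using up[of "y 1"] by (simp only: form mult_1 mult.commute[of \<rho>])
  qed
  then have "sqrt (p * q) \<le> \<rho>" using pq by (simp only: mult_le_cancel_left_pos mult_pos_pos zero_less_numeral)
  moreover have "(2 * (p * q)) * \<mu> \<le> (2 * (p * q)) * (- sqrt (p * q))"
  proof -
    have "(\<Sum>i\<in>?V. (y (- 1) i)\<^sup>2) = 2 * (p * q)" by (rule norm) simp
    then show ?thesis
      using low[of "y (- 1)"] by (simp only: form mult_1 mult_minus_left mult_minus_right mult.commute[of \<mu>])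
  qed
  then have "\<mu> \<le> - sqrt (p * q)" using pq by (simp only: mult_le_cancel_left_pos mult_pos_pos zero_less_numeral)
  ultimately show ?thesis unfolding sp p_def q_def by simp
qed

text \<open>The test vectors beat both Rayleigh bounds of \<open>E\<close>; strictness already
  excludes zero vectors, so their norms can be cancelled.\<close>

lemma spread_join_graph_greater:
  assumes G: "simple_graph n E" and H: "simple_graph n H" and "n > 0" and sp: "spread n E = \<rho> - \<mu>"
    and up: "\<rho> * (\<Sum>i\<in>{0..<n}. (y i)\<^sup>2) < (\<Sum>i\<in>{0..<n}. \<Sum>j\<in>{0..<n}. adj H i j * (y i * y j))"
    and low: "(\<Sum>i\<in>{0..<n}. \<Sum>j\<in>{0..<n}. adj H i j * (w i * w j)) < \<mu> * (\<Sum>i\<in>{0..<n}. (w i)\<^sup>2)"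
  shows "spread n E < spread n H"
proof -
  obtain \<rho>' \<mu>' where sp': "spread n H = \<rho>' - \<mu>'"
    and up': "\<And>y. (\<Sum>i\<in>{0..<n}. \<Sum>j\<in>{0..<n}. adj H i j * (y i * y j)) \<le> \<rho>' * (\<Sum>i\<in>{0..<n}. (y i)\<^sup>2)"
    and low': "\<And>y. (\<Sum>i\<in>{0..<n}. \<Sum>j\<in>{0..<n}. adj H i j * (y i * y j)) \<ge> \<mu>' * (\<Sum>i\<in>{0..<n}. (y i)\<^sup>2)"
    by (rule spread_eigenpairs[OF H \<open>n > 0\<close>]) (rule that)
  have nonneg: "0 \<le> (\<Sum>i\<in>{0..<n}. (f i)\<^sup>2)" for f :: "nat \<Rightarrow> real" by (simp add: sum_nonneg)
  have "\<rho> * (\<Sum>i\<in>{0..<n}. (y i)\<^sup>2) < \<rho>' * (\<Sum>i\<in>{0..<n}. (y i)\<^sup>2)"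
    using up up'[of y] by linarith
  then have "\<rho> < \<rho>'" using nonneg[of y] by (rule mult_right_less_imp_less)
  moreover have "\<mu>' * (\<Sum>i\<in>{0..<n}. (w i)\<^sup>2) < \<mu> * (\<Sum>i\<in>{0..<n}. (w i)\<^sup>2)"
    using low low'[of w] by linarith
  then have "\<mu>' < \<mu>" using nonneg[of w] by (rule mult_right_less_imp_less)
  ultimately show ?thesis unfolding sp sp' by linarith
qed

theorem theorem3p8:
  fixes r :: nat
  assumes "r \<ge> 3"
  shows "\<exists>N. \<forall>n \<ge> N. \<forall>E. simple_graph n E \<and> K_minor_free r n E \<and>
           (\<forall>E'. simple_graph n E' \<and> K_minor_free r n E' \<longrightarrow> spread n E' \<le> spread n E) \<longrightarrow>
           (\<exists>L \<subseteq> {0..<n}. card L = r - 2 \<and>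
              (\<forall>u\<in>L. \<forall>v\<in>{0..<n} - L. E u v) \<and>
              (\<forall>u\<in>{0..<n} - L. \<forall>v\<in>{0..<n} - L. \<not> E u v))"
proof -
  define s d :: nat where "s = r - 2" and "d = 2 ^ r"
  define \<delta> :: real where "\<delta> = 1 / (4 * (d + 2))"
  define \<theta> where "\<theta> = \<delta>\<^sup>2 / (2 * s)"
  define \<eta> where "\<eta> = \<theta> / 8"
  define \<gamma> where "\<gamma> = \<eta> / (2 * d + 5)"
  \<comment> \<open>\<open>error_bound\<close> depends on d, s and \<gamma> only, so the threshold
    precedes the graph. With \<open>max 0\<close>, one inequality yields both \<open>err\<close> and
    2 s \<le> \<gamma> sqrt n.\<close>
  define C where "C = (max 0 (sparse_graph.error_bound d s \<gamma>) + 2 * s) / \<gamma>"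
  \<comment> \<open>The summand 2 (s + 3) ensures that three quarters of n vertices are at least the
    s + 3 fully joined ones which the minor arguments ask for.\<close>
  define N where "N = nat \<lceil>C\<^sup>2\<rceil> + 2 * (s + 3)"
  have s: "s \<ge> 1" "s + 2 = r" using assms by (auto simp: s_def)
  have \<delta>: "0 < \<delta>" "\<delta> \<le> 1/4"
  proof -
    show "0 < \<delta>" by (simp add: \<delta>_def)
    have "1 / (4 * (real d + 2)) \<le> 1 / 4" by (intro divide_left_mono) auto
    then show "\<delta> \<le> 1/4" by (simp add: \<delta>_def)
  qed
  then have \<gamma>: "\<gamma> > 0" using s by (simp add: \<gamma>_def \<eta>_def \<theta>_def)
  show ?thesis
  proof (intro exI[of _ N] allI impI, elim conjE)
    fix n E
    assume n: "N \<le> n" and G: "simple_graph n E" and free: "K_minor_free r n E"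
      and max: "\<forall>E'. simple_graph n E' \<and> K_minor_free r n E' \<longrightarrow> spread n E' \<le> spread n E"
    let ?V = "{0..<n}"
    have n0: "n > 0" "s < n" "2 * (s + 3) \<le> n" using n by (auto simp: N_def)
    have E: "E b a \<and> a \<noteq> b" if "E a b" for a b
      using G that unfolding simple_graph_def by blast
    interpret sparse_graph E ?V d s
      unfolding d_def s_def using G free assms n0(1) by (rule sparse_graph_K_minor_free)
    have cV: "card ?V = n" by simp
    have "C\<^sup>2 \<le> n" using n unfolding N_def by linarith
    then have "C \<le> sqrt n" by (rule real_le_rsqrt)
    then have "max 0 (error_bound \<gamma>) + 2 * s \<le> \<gamma> * sqrt n"
      using \<gamma> by (simp add: C_def pos_divide_le_eq mult.commute)
    then have err: "error_bound \<gamma> \<le> \<gamma> * sqrt n" and s\<gamma>: "2 * s \<le> \<gamma> * sqrt n" by linarith+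
    obtain \<rho> \<mu> x z where sp: "spread n E = \<rho> - \<mu>"
      and x: "(\<Sum>i\<in>?V. (x i)\<^sup>2) = 1" "\<And>i. i < n \<Longrightarrow> (\<Sum>j\<in>?V. adj E i j * x j) = \<rho> * x i"
      and z: "(\<Sum>i\<in>?V. (z i)\<^sup>2) = 1" "\<And>i. i < n \<Longrightarrow> (\<Sum>j\<in>?V. adj E i j * z j) = \<mu> * z i"
      by (rule spread_eigenpairs[OF G n0(1)]) (rule that)
    have gap: "2 * sqrt (s * n) - \<gamma> * sqrt n \<le> \<rho> - \<mu>"
    proof -
      let ?B = "join_graph ?V {0..<s} (\<lambda>_ _. False)"
      have "simple_graph n ?B" using n0 by (intro simple_join_graph) (auto simp: simple_graph_def)
      moreover have "K_minor_free r n ?B" using n0 s by (intro K_minor_free_join_graph) auto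
      ultimately have "spread n ?B \<le> \<rho> - \<mu>" using max sp by simp
      then have 1: "2 * sqrt (real s * (real n - real s)) \<le> \<rho> - \<mu>"
        using spread_complete_bipartite[of s n] s n0 by linarith
      \<comment> \<open>Replacing n - s by n under the root costs at most s, hence 2 s in the
        spread.\<close>
      have "real (s * n) = real s * (real n - real s) + (real s)\<^sup>2"
        by (simp add: power2_eq_square algebra_simps)
      then have "sqrt (s * n) \<le> sqrt (real s * (real n - real s)) + sqrt ((real s)\<^sup>2)"
        using n0 by (simp only:) (intro sqrt_add_le_add_sqrt, auto)
      then show ?thesis using 1 s\<gamma> by simp
    qed
    obtain L m k where L: "card L = s" "L \<subseteq> ?V" and mk: "m \<noteq> 0" "k \<noteq> 0" and sgn: "\<rho> > 0" "\<mu> < 0"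
      and xL: "\<And>l. l \<in> L \<Longrightarrow> \<bar>x l - m\<bar> \<le> \<delta> * \<bar>m\<bar>" "\<And>l. l \<in> ?V - L \<Longrightarrow> \<bar>x l\<bar> \<le> \<delta> * \<bar>m\<bar>"
      and zL: "\<And>l. l \<in> L \<Longrightarrow> \<bar>z l - k\<bar> \<le> \<delta> * \<bar>k\<bar>" "\<And>l. l \<in> ?V - L \<Longrightarrow> \<bar>z l\<bar> \<le> \<delta> * \<bar>k\<bar>"
      and full: "4 * card {u \<in> ?V - L. \<forall>l\<in>L. E u l} \<ge> 3 * card ?V"
    proof (rule common_structure[of \<delta> \<theta> \<eta> \<gamma> x \<rho> z \<mu>])
      show "error_bound \<gamma> \<le> \<gamma> * sqrt (card ?V)" using err by simp
      show "2 * sqrt (s * card ?V) - \<gamma> * sqrt (card ?V) \<le> \<rho> - \<mu>" using gap by simp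
      show "(\<Sum>j\<in>?V. adj E i j * x j) = \<rho> * x i" if "i \<in> ?V" for i using that x(2) by simp
      show "(\<Sum>j\<in>?V. adj E i j * z j) = \<mu> * z i" if "i \<in> ?V" for i using that z(2) by simp
    qed (rule \<delta> \<theta>_def \<eta>_def \<gamma>_def x(1) z(1) that, assumption?)+
    define W where "W = {u \<in> ?V - L. \<forall>l\<in>L. E u l}"
    define T where "T = {u \<in> ?V - L. \<exists>l\<in>L. \<not> E u l}"
    have "card W \<ge> s + 3" using full n0 unfolding W_def[symmetric] by simp
    moreover have "\<not> K_minor_in (s + 2) E ?V"
      using free s by (simp add: K_minor_free_def has_K_minor_eq)
    ultimately have W: "\<And>u w. u \<in> W \<Longrightarrow> w \<in> W \<Longrightarrow> \<not> E u w"
      "\<And>t. t \<in> ?V - L - W \<Longrightarrow> card {w \<in> W. E t w} \<le> 1"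
      using common_neighbours_off_edges[OF E finV(1) L(2) _ W_def] L(1) by simp_all
    have T: "T = ?V - L - W" by (auto simp: T_def W_def)
    have "T = {}"
    proof (rule ccontr)
      assume "T \<noteq> {}"
      have vol: "vol E (?V - L) \<le> (d + 2) * card T"
        unfolding T
      proof (rule vol_off_common_neighbours)
        show "vol E (?V - L - W) \<le> d * card (?V - L - W)" by (rule sparse) blast
        show "W \<subseteq> ?V - L" by (auto simp: W_def)
        show "finite (?V - L)" by simp
        show "\<not> E u w" if "u \<in> W" "w \<in> W" for u w using that by (rule W(1))
        show "card {w \<in> W. E t w} \<le> 1" if "t \<in> ?V - L - W" for t using that by (rule W(2))
      qed (rule E)
      let ?H = "join_graph ?V L E"
      define gain where "gain x = (\<Sum>u\<in>?V - L. (\<Sum>l\<in>L. x l)\<^sup>2 - (\<Sum>l\<in>L. adj E u l * x l)\<^sup>2)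
        - (\<Sum>u\<in>?V - L. (\<Sum>l\<in>L. adj E u l * x l) * (\<Sum>v\<in>?V - L. adj E u v * x v))" for x
      note gain_pos = join_gain_pos[OF L(2,1) T_def \<open>T \<noteq> {}\<close> vol \<delta>_def]
      have "gain x > 0" unfolding gain_def by (rule gain_pos[OF mk(1)]) (erule xL | rule refl)+
      have "gain z > 0" unfolding gain_def by (rule gain_pos[OF mk(2)]) (erule zL | rule refl)+
      define y where "y c x i = (if i \<in> L then x i else (\<Sum>l\<in>L. x l) / c)" for c :: real and x i
      have "\<rho> * ((\<Sum>i\<in>?V. \<Sum>j\<in>?V. adj ?H i j * (y \<rho> x i * y \<rho> x j)) - \<rho> * (\<Sum>i\<in>?V. (y \<rho> x i)\<^sup>2)) = gain x"
        unfolding gain_def using sgn x(2) by (intro join_test_vector[OF L(2)]) (auto simp: y_def)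
      then have "0 < \<rho> * ((\<Sum>i\<in>?V. \<Sum>j\<in>?V. adj ?H i j * (y \<rho> x i * y \<rho> x j)) - \<rho> * (\<Sum>i\<in>?V. (y \<rho> x i)\<^sup>2))"
        using \<open>gain x > 0\<close> by (simp only:)
      then have up: "\<rho> * (\<Sum>i\<in>?V. (y \<rho> x i)\<^sup>2) < (\<Sum>i\<in>?V. \<Sum>j\<in>?V. adj ?H i j * (y \<rho> x i * y \<rho> x j))"
        using sgn(1) unfolding zero_less_mult_iff by linarith
      have "\<mu> * ((\<Sum>i\<in>?V. \<Sum>j\<in>?V. adj ?H i j * (y \<mu> z i * y \<mu> z j)) - \<mu> * (\<Sum>i\<in>?V. (y \<mu> z i)\<^sup>2)) = gain z"
        unfolding gain_def using sgn z(2) by (intro join_test_vector[OF L(2)]) (auto simp: y_def)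
      then have "0 < \<mu> * ((\<Sum>i\<in>?V. \<Sum>j\<in>?V. adj ?H i j * (y \<mu> z i * y \<mu> z j)) - \<mu> * (\<Sum>i\<in>?V. (y \<mu> z i)\<^sup>2))"
        using \<open>gain z > 0\<close> by (simp only:)
      \<comment> \<open>Since \<mu> < 0, the same positive gain puts the form below \<mu> times the
        squared norm.\<close>
      then have low: "(\<Sum>i\<in>?V. \<Sum>j\<in>?V. adj ?H i j * (y \<mu> z i * y \<mu> z j)) < \<mu> * (\<Sum>i\<in>?V. (y \<mu> z i)\<^sup>2)"
        using sgn(2) unfolding zero_less_mult_iff by linarith
      have H: "simple_graph n ?H" using G L(2) by (rule simple_join_graph)
      have "spread n E < spread n ?H"
        using G H n0(1) sp up low by (rule spread_join_graph_greater)
      moreover have "K_minor_free r n ?H" using L s by (intro K_minor_free_join_graph) auto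
      ultimately show False using max[rule_format, of ?H] H by simp
    qed
    then have "?V - L = W" using T by (auto simp: W_def)
    show "\<exists>L\<subseteq>?V. card L = r - 2 \<and> (\<forall>u\<in>L. \<forall>v\<in>?V - L. E u v) \<and> (\<forall>u\<in>?V - L. \<forall>v\<in>?V - L. \<not> E u v)"
    proof (intro exI[of _ L] conjI ballI)
      show "L \<subseteq> ?V" "card L = r - 2" using L by (simp_all add: s_def)
      show "E u v" if "u \<in> L" "v \<in> ?V - L" for u v
        using that E[of v u] unfolding \<open>?V - L = W\<close> by (simp add: W_def)
      show "\<not> E u v" if "u \<in> ?V - L" "v \<in> ?V - L" for u v
        using that unfolding \<open>?V - L = W\<close> by (rule W(1))
    qed
  qed
qed

end
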